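(* Let $Q\subseteq V$ be a polyhedron. The assignment \[\mathcal F:\mathbb I(\mathrm{Def}^+(Q))\to\mathbb Z^{\oplus\mathrm{tran}(\Sigma_Q^\vee)},\qquad \mathbf 1_P\mapsto\sum_{\substack{C+v\in\mathrm{tran}(\Sigma_Q^\vee)\\ C+v\text{ tightly contains }P}}\mathbf e_{C+v}\] is a well-defined (in particular the sum is finite) $\mathbb Z$-linear isomorphism. Consequently, writing $\mathcal F(P):=\mathcal F(\mathbf 1_P)$, for every valuative function $f:\mathrm{Def}^+(Q)\to A$ to an abelian group $A$ there is a unique $\mathbb Z$-linear map $g:\mathbb Z^{\oplus\mathrm{tran}(\Sigma_Q^\vee)}\to A$ with $f=g\circ\mathcal F$.
   Context: $V$ is a finite-dimensional real vector space. $\mathbf 1_P$ is the indicator function of $P$; $\mathbb I(\mathscr P)\subseteq\mathbb Z^V$ is the $\mathbb Z$-span of indicator functions of members of a family $\mathscr P$. A function $f:\mathscr P\to A$ is valuative if $\sum a_if(P_i)=0$ whenever $\sum a_i\mathbf 1_{P_i}=0$ ($a_i\in\mathbb Z$). For a polyhedron $Q$, $\Sigma_Q$ is its outer normal fan, and for a face $F$ the tangent cone is $C_F=\mathrm{Cone}(v'-v\mid v\in F,v'\in Q)$; $\Sigma_Q^\vee$ is the set of tangent cones of $Q$ and $\mathrm{tran}(\Sigma_Q^\vee)=\{C+v:C\in\Sigma_Q^\vee,v\in V\}$. $\mathrm{Def}^+(Q)$ is the set of polyhedra $P$ each of whose normal cones in $\Sigma_P$ is a union of cones of $\Sigma_Q$.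 $\mathbb Z^{\oplus S}$ is the free abelian group with basis $\{\mathbf e_s:s\in S\}$. A translate $C+v$ tightly contains $P$ if $P\subseteq C+v$ and $P\cap(\mathrm{lineal}(C)+v)\ne\emptyset$, where $\mathrm{lineal}(C)$ is the lineality space of $C$. *)

theory Defs
  imports "HOL-Analysis.Analysis"
begin

definition normal_cone :: "'a::euclidean_space set \<Rightarrow> 'a set \<Rightarrow> 'a set" where
  "normal_cone Q F = {u. \<forall>y\<in>F. \<forall>x\<in>Q. u \<bullet> x \<le> u \<bullet> y}"

definition normal_fan :: "'a::euclidean_space set \<Rightarrow> 'a set set" where
  "normal_fan Q = {normal_cone Q F | F. F face_of Q \<and> F \<noteq> {}}"

definition tangent_cone :: "'a::euclidean_space set \<Rightarrow> 'a set \<Rightarrow> 'a set" where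
  "tangent_cone Q F = convex_cone hull {v' - v | v v'. v \<in> F \<and> v' \<in> Q}"

definition tangent_cones :: "'a::euclidean_space set \<Rightarrow> 'a set set" where
  "tangent_cones Q = {tangent_cone Q F | F. F face_of Q \<and> F \<noteq> {}}"

definition tran :: "'a::euclidean_space set \<Rightarrow> 'a set set" where
  "tran Q = {(\<lambda>x. x + v) ` C | C v. C \<in> tangent_cones Q}"

definition lineal :: "'a::euclidean_space set \<Rightarrow> 'a set" where
  "lineal C = C \<inter> uminus ` C"

definition tightly_contains :: "'a::euclidean_space set \<Rightarrow> 'a set \<Rightarrow> 'a set \<Rightarrow> bool" where
  "tightly_contains Q T P \<longleftrightarrow>
     (\<exists>C v. C \<in> tangent_cones Q \<and> T = (\<lambda>x. x + v) ` C \<and> P \<subseteq> T \<and>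
            P \<inter> ((\<lambda>x. x + v) ` lineal C) \<noteq> {})"

definition DefPlus :: "'a::euclidean_space set \<Rightarrow> 'a set set" where
  "DefPlus Q = {P. polyhedron P \<and>
     (\<forall>N\<in>normal_fan P. \<exists>S\<subseteq>normal_fan Q. N = \<Union>S)}"

definition int_span :: "'a set set \<Rightarrow> ('a \<Rightarrow> int) set" where
  "int_span X = {\<phi>. \<exists>S c. finite S \<and> S \<subseteq> X \<and>
                      \<phi> = (\<lambda>x. \<Sum>P\<in>S. c P * indicator P x)}"

definition free_ab :: "'s set \<Rightarrow> ('s \<Rightarrow> int) set" where
  "free_ab S = {\<phi>. finite {s. \<phi> s \<noteq> 0} \<and> (\<forall>s. \<phi> s \<noteq> 0 \<longrightarrow> s \<in> S)}"

definition basis_e :: "'s \<Rightarrow> ('s \<Rightarrow> int)" where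
  "basis_e s = (\<lambda>t. if t = s then 1 else 0)"

definition Fimg :: "'a::euclidean_space set \<Rightarrow> 'a set \<Rightarrow> ('a set \<Rightarrow> int)" where
  "Fimg Q P = (\<lambda>t. \<Sum>T\<in>{T\<in>tran Q. tightly_contains Q T P}. basis_e T t)"

definition zlinear_on :: "('c \<Rightarrow> int) set \<Rightarrow> (('c \<Rightarrow> int) \<Rightarrow> 'b::ab_group_add) \<Rightarrow> bool" where
  "zlinear_on A g \<longleftrightarrow> (\<forall>x\<in>A. \<forall>y\<in>A. g (\<lambda>t. x t + y t) = g x + g y)"

definition zlinear_fun_on :: "('c \<Rightarrow> int) set \<Rightarrow> (('c \<Rightarrow> int) \<Rightarrow> ('d \<Rightarrow> int)) \<Rightarrow> bool" where
  "zlinear_fun_on A g \<longleftrightarrow> (\<forall>x\<in>A. \<forall>y\<in>A. g (\<lambda>t. x t + y t) = (\<lambda>s. g x s + g y s))"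

definition zsmult :: "int \<Rightarrow> 'b::ab_group_add \<Rightarrow> 'b" where
  "zsmult k a = (if 0 \<le> k then (\<Sum>i<nat k. a) else - (\<Sum>i<nat (- k). a))"

definition valuative :: "'a set set \<Rightarrow> ('a set \<Rightarrow> 'b::ab_group_add) \<Rightarrow> bool" where
  "valuative X f \<longleftrightarrow>
     (\<forall>S c. finite S \<and> S \<subseteq> X \<and> (\<lambda>x. \<Sum>P\<in>S. c P * (indicator P x :: int)) = (\<lambda>x. 0)
        \<longrightarrow> (\<Sum>P\<in>S. zsmult (c P) (f P)) = 0)"

end

theory Submission
  imports Defs "HOL-Library.Function_Algebras"
begin

text \<open>
  To a polyhedron \<open>P\<close> attach the function \<open>D P (u, m)\<close>, which is 1 if the linear functional \<open>u\<close> attains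
  its maximum on \<open>P\<close> with value \<open>m\<close>, and 0 otherwise. The relations among indicator functions and the
  relations among these functions are the same. In one direction, the Euler characteristic (the
  valuation that is 1 on every nonempty closed convex set) of the slices of \<open>P\<close> gives the indicator
  function of the interval \<open>u \<bullet> P\<close>, whose right endpoint is then seen by a one-sided limit. Conversely, for
  nonempty \<open>P\<close>, the closed convex set of all \<open>u\<close> with \<open>u \<bullet> (p - x) \<le> -1\<close> for all \<open>p \<in> P\<close> is empty
  iff \<open>x \<in> P\<close>, and its indicator function is a sum of values of \<open>D P\<close>.

  For \<open>P \<in> DefPlus Q\<close> all functionals exposing a given face of \<open>Q\<close> attain their maximum on \<open>P\<close> at the
  same points, modulo the lineality space of the tangent cone. Hence \<open>D P\<close> and \<open>Fimg Q P\<close> determine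
  each other linearly, and \<open>1\<^sub>P \<mapsto> Fimg Q P\<close> is well defined and injective. It is surjective because
  it is unitriangular on the translated tangent cones, which belong to \<open>DefPlus Q\<close>.
\<close>

section \<open>Euler characteristic and maxima of linear functionals\<close>

text \<open>For \<open>s\<close> slightly larger than \<open>t\<close>, the indicator of
  \<open>t\<close> being the maximum equals
  \<open>of_bool (t \<in> J i) - of_bool (s \<in> J i)\<close>. Finitely many sets admit a common
  \<open>s\<close>, so the claim is the difference of the given relations at \<open>t\<close> and at
  \<open>s\<close>.\<close>

lemma sum_of_bool_max_eq_0:
  fixes J :: "'i \<Rightarrow> real set" and c :: "'i \<Rightarrow> int"
  assumes fin: "finite I" and cl: "\<And>i. i \<in> I \<Longrightarrow> closed (J i)"
    and cv: "\<And>i. i \<in> I \<Longrightarrow> convex (J i)"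
    and z: "\<And>t. (\<Sum>i\<in>I. c i * of_bool (t \<in> J i)) = 0"
  shows "(\<Sum>i\<in>I. c i * of_bool (t \<in> J i \<and> (\<forall>y\<in>J i. y \<le> t))) = 0"
proof -
  have ev: "\<forall>\<^sub>F s in at_right t. of_bool (t \<in> J i \<and> (\<forall>y\<in>J i. y \<le> t))
              = (of_bool (t \<in> J i) - of_bool (s \<in> J i) :: int)" if i: "i \<in> I" for i
  proof -
    \<comment> \<open>Outside \<open>J i\<close>, closedness keeps nearby \<open>s\<close> outside;
      at the maximum, every \<open>s > t\<close> is outside; otherwise convexity puts all
      \<open>s\<close> between \<open>t\<close> and \<open>y\<close> inside.\<close>
    consider "t \<notin> J i" | "t \<in> J i" "\<forall>y\<in>J i. y \<le> t" | y where "t \<in> J i" "y \<in> J i" "y > t"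
      by (meson not_le)
    then show ?thesis
    proof cases
      case 1
      have "open (- J i)" using cl[OF i] by blast
      then have "\<forall>\<^sub>F s in at t. s \<in> - J i"
        using 1 eventually_at_in_open' by blast
      then have "\<forall>\<^sub>F s in at_right t. s \<notin> J i"
        by (simp add: eventually_at_split)
      then show ?thesis by eventually_elim (use 1 in auto)
    next
      case 2
      have "\<forall>\<^sub>F s in at_right t. s > t"
        by (simp add: eventually_at_right_less)
      then show ?thesis by eventually_elim (use 2 in auto)
    next
      case 3
      have "\<forall>\<^sub>F s in at_right t. s < y"
        using 3 by (simp add: eventually_at_right_field) blast
      moreover have "\<forall>\<^sub>F s in at_right t. s > t"
        by (simp add: eventually_at_right_less)
      ultimately show ?thesis
      proof eventually_elim
        case (elim s)
        have "is_interval (J i)" using cv[OF i] by (simp add: is_interval_convex_1)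
        then have "s \<in> J i" using 3 elim by (meson is_interval_1 less_imp_le)
        moreover have "\<not> (\<forall>y\<in>J i. y \<le> t)" using 3 by (meson not_le)
        ultimately show ?case using 3 by simp
      qed
    qed
  qed
  have "\<forall>\<^sub>F s in at_right t. \<forall>i\<in>I. of_bool (t \<in> J i \<and> (\<forall>y\<in>J i. y \<le> t))
              = (of_bool (t \<in> J i) - of_bool (s \<in> J i) :: int)"
    using ev fin by (simp add: eventually_ball_finite)
  then obtain s where s: "\<forall>i\<in>I. of_bool (t \<in> J i \<and> (\<forall>y\<in>J i. y \<le> t))
              = (of_bool (t \<in> J i) - of_bool (s \<in> J i) :: int)"
    using eventually_happens'[of "at_right t"] by fastforce
  have "(\<Sum>i\<in>I. c i * of_bool (t \<in> J i \<and> (\<forall>y\<in>J i. y \<le> t)))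
      = (\<Sum>i\<in>I. c i * of_bool (t \<in> J i)) - (\<Sum>i\<in>I. c i * of_bool (s \<in> J i))"
    unfolding sum_subtractf[symmetric] right_diff_distrib[symmetric]
    by (rule sum.cong) (use s in auto)
  then show ?thesis using z by simp
qed

text \<open>A nonempty compact interval has exactly one maximum, so its Euler characteristic 1 is
  the sum of its endpoint indicator over a finite set containing all maxima in question.\<close>

lemma sum_of_bool_nonempty_eq_0_real:
  fixes J :: "'i \<Rightarrow> real set" and c :: "'i \<Rightarrow> int"
  assumes fin: "finite I" and cp: "\<And>i. i \<in> I \<Longrightarrow> compact (J i)"
    and cv: "\<And>i. i \<in> I \<Longrightarrow> convex (J i)"
    and z: "\<And>t. (\<Sum>i\<in>I. c i * of_bool (t \<in> J i)) = 0"
  shows "(\<Sum>i\<in>I. c i * of_bool (J i \<noteq> {})) = 0"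
proof -
  \<comment> \<open>The conjunct \<open>J i \<noteq> {}\<close> guards against the meaningless value
    \<open>Sup {}\<close>, which enters the index set below but is no maximum of the empty
    set.\<close>
  have mx: "(t \<in> J i \<and> (\<forall>y\<in>J i. y \<le> t)) \<longleftrightarrow> J i \<noteq> {} \<and> t = Sup (J i)" if i: "i \<in> I" for i t
  proof
    assume "J i \<noteq> {} \<and> t = Sup (J i)"
    then show "t \<in> J i \<and> (\<forall>y\<in>J i. y \<le> t)"
      using cp[OF i] by (metis bounded_imp_bdd_above cSup_upper closed_contains_Sup compact_eq_bounded_closed)
  next
    assume "t \<in> J i \<and> (\<forall>y\<in>J i. y \<le> t)"
    then show "J i \<noteq> {} \<and> t = Sup (J i)"
      by (metis cSup_eq_maximum empty_iff)
  qed
  have "(\<Sum>i\<in>I. c i * of_bool (J i \<noteq> {}))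
      = (\<Sum>i\<in>I. \<Sum>t\<in>(\<lambda>i. Sup (J i)) ` I. c i * of_bool (t \<in> J i \<and> (\<forall>y\<in>J i. y \<le> t)))"
  proof (rule sum.cong[OF refl])
    fix i assume i: "i \<in> I"
    have "(\<Sum>t\<in>(\<lambda>i. Sup (J i)) ` I. c i * of_bool (t \<in> J i \<and> (\<forall>y\<in>J i. y \<le> t)))
        = (\<Sum>t\<in>(\<lambda>i. Sup (J i)) ` I. if t = Sup (J i) then c i * of_bool (J i \<noteq> {}) else 0)"
      by (rule sum.cong[OF refl]) (simp only: mx[OF i], auto)
    also have "\<dots> = c i * of_bool (J i \<noteq> {})"
      using i fin by (subst sum.delta) auto
    finally show "c i * of_bool (J i \<noteq> {})
      = (\<Sum>t\<in>(\<lambda>i. Sup (J i)) ` I. c i * of_bool (t \<in> J i \<and> (\<forall>y\<in>J i. y \<le> t)))" by simp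
  qed
  also have "\<dots> = (\<Sum>t\<in>(\<lambda>i. Sup (J i)) ` I. \<Sum>i\<in>I. c i * of_bool (t \<in> J i \<and> (\<forall>y\<in>J i. y \<le> t)))"
    by (rule sum.swap)
  also have "\<dots> = 0"
    by (rule sum.neutral)
      (use sum_of_bool_max_eq_0[OF fin _ cv z] cp compact_imp_closed in blast)
  finally show ?thesis .
qed

text \<open>Induction on the number of free coordinates: a slice is nonempty iff its projection to
  one axis is, this projection is a compact interval, and its fibres are slices with one free
  coordinate fewer, so the one-dimensional case applies.\<close>

lemma sum_of_bool_nonempty_eq_0_compact:
  fixes K :: "'i \<Rightarrow> 'a::euclidean_space set" and c :: "'i \<Rightarrow> int"
  assumes fin: "finite I" and cp: "\<And>i. i \<in> I \<Longrightarrow> compact (K i)"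
    and cv: "\<And>i. i \<in> I \<Longrightarrow> convex (K i)"
    and z: "\<And>x. (\<Sum>i\<in>I. c i * of_bool (x \<in> K i)) = 0"
  shows "(\<Sum>i\<in>I. c i * of_bool (K i \<noteq> {})) = 0"
proof -
  \<comment> \<open>The affine subspace through \<open>w\<close> in which the coordinates in
    \<open>B\<close> vary: a point for \<open>B = {}\<close>, the whole space for
    \<open>B = Basis\<close>.\<close>
  define L where "L B w = {x::'a. \<forall>b\<in>Basis - B. x \<bullet> b = w \<bullet> b}" for B w
  have "finite B \<Longrightarrow> B \<subseteq> Basis \<Longrightarrow>
      (\<Sum>i\<in>I. c i * of_bool (K i \<inter> L B w \<noteq> {})) = 0" for B w
  proof (induction B arbitrary: w rule: finite_induct)
    case empty
    have "L {} w = {w}" unfolding L_def by (auto intro: euclidean_eqI)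
    then show ?case using z[of w] by simp
  next
    case (insert b B)
    have Lb: "L (insert b B) w = (\<Inter>b'\<in>Basis - insert b B. {x. b' \<bullet> x = w \<bullet> b'})"
      unfolding L_def by (auto simp: inner_commute)
    have clL: "closed (L (insert b B) w)" unfolding Lb
      by (intro closed_INT ballI closed_hyperplane)
    have cvL: "convex (L (insert b B) w)" unfolding Lb
      by (intro convex_INT convex_hyperplane)
    let ?J = "\<lambda>i. (\<lambda>x. x \<bullet> b) ` (K i \<inter> L (insert b B) w)"
    have "(\<Sum>i\<in>I. c i * of_bool (?J i \<noteq> {})) = 0"
    proof (rule sum_of_bool_nonempty_eq_0_real[OF fin])
      fix i assume i: "i \<in> I"
      show "compact (?J i)"
        by (intro compact_continuous_image continuous_intros compact_Int_closed cp clL i)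
      show "convex (?J i)"
        by (rule convex_linear_image) (auto intro!: convex_Int cv cvL i bounded_linear.linear bounded_linear_intros)
    next
      fix t
      \<comment> \<open>The base point on the right is \<open>w\<close> with its
        \<open>b\<close>-coordinate changed to \<open>t\<close>, so its slice is the fibre of the
        projection over \<open>t\<close>.\<close>
      have "t \<in> ?J i \<longleftrightarrow> K i \<inter> L B (w + (t - w \<bullet> b) *\<^sub>R b) \<noteq> {}" for i
      proof -
        have "x \<in> L B (w + (t - w \<bullet> b) *\<^sub>R b) \<longleftrightarrow> x \<in> L (insert b B) w \<and> x \<bullet> b = t" for x
        proof -
          have "Basis - B = insert b (Basis - insert b B)" using insert by auto
          then show ?thesis using insert
            by (auto simp: L_def inner_add_left inner_Basis algebra_simps)
        qed
        then show ?thesis by auto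
      qed
      then show "(\<Sum>i\<in>I. c i * of_bool (t \<in> ?J i)) = 0"
        using insert.IH insert.prems by simp
    qed
    then show ?case by simp
  qed
  from this[of Basis 0] show ?thesis by (simp add: L_def)
qed

text \<open>One large ball meets all the nonempty sets among finitely many; intersecting with it
  multiplies the relation by its indicator and reduces to the compact case.\<close>

lemma sum_of_bool_nonempty_eq_0:
  fixes K :: "'i \<Rightarrow> 'a::euclidean_space set" and c :: "'i \<Rightarrow> int"
  assumes fin: "finite I" and cl: "\<And>i. i \<in> I \<Longrightarrow> closed (K i)"
    and cv: "\<And>i. i \<in> I \<Longrightarrow> convex (K i)"
    and z: "\<And>x. (\<Sum>i\<in>I. c i * of_bool (x \<in> K i)) = 0"
  shows "(\<Sum>i\<in>I. c i * of_bool (K i \<noteq> {})) = 0"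
proof -
  have "\<forall>\<^sub>F r in at_top. \<forall>i\<in>I. K i \<inter> cball 0 r \<noteq> {} \<longleftrightarrow> K i \<noteq> {}"
  proof (rule eventually_ball_finite[OF fin], rule ballI)
    fix i
    show "\<forall>\<^sub>F r in at_top. K i \<inter> cball 0 r \<noteq> {} \<longleftrightarrow> K i \<noteq> {}"
    proof (cases "K i = {}")
      case False
      then obtain x where "x \<in> K i" by auto
      have "\<forall>\<^sub>F r in at_top. r \<ge> norm x" by (rule eventually_ge_at_top)
      then show ?thesis by eventually_elim (use \<open>x \<in> K i\<close> in auto)
    qed auto
  qed
  then obtain r where r: "\<forall>i\<in>I. K i \<inter> cball 0 r \<noteq> {} \<longleftrightarrow> K i \<noteq> {}"
    using eventually_happens'[OF trivial_limit_at_top_linorder] by blast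
  have "(\<Sum>i\<in>I. c i * of_bool (K i \<inter> cball 0 r \<noteq> {})) = 0"
  proof (rule sum_of_bool_nonempty_eq_0_compact[OF fin])
    fix x
    have "(\<Sum>i\<in>I. c i * of_bool (x \<in> K i \<inter> cball 0 r))
        = (\<Sum>i\<in>I. c i * of_bool (x \<in> K i)) * of_bool (x \<in> cball 0 r)"
      unfolding sum_distrib_right by (rule sum.cong) auto
    then show "(\<Sum>i\<in>I. c i * of_bool (x \<in> K i \<inter> cball 0 r)) = 0" using z by simp
  qed (use cl cv in \<open>auto intro: closed_Int_compact convex_Int\<close>)
  then show ?thesis using r by (simp cong: sum.cong)
qed

section \<open>Maxima of linear functionals on polyhedra\<close>

text \<open>Its truth value is the \<open>D P (u, m)\<close> of the introduction; if
  \<open>u\<close> is unbounded above on \<open>P\<close>, or \<open>P\<close> is empty, it holds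
  for no \<open>m\<close>.\<close>

definition attains_max :: "'a::euclidean_space set \<Rightarrow> 'a \<Rightarrow> real \<Rightarrow> bool" where
  "attains_max P u m \<longleftrightarrow> (\<exists>x\<in>P. u \<bullet> x = m) \<and> (\<forall>x\<in>P. u \<bullet> x \<le> m)"

text \<open>Induction on dimension. Without a maximum, every point could be moved within
  \<open>P\<close>, increasing \<open>u\<close>, until it meets a facet. By induction
  \<open>u\<close> has a maximum on each of the finitely many facets, and the largest of these
  values would be a maximum on \<open>P\<close>.\<close>

lemma polyhedron_attains_max:
  fixes P :: "'a::euclidean_space set"
  assumes "polyhedron P" "P \<noteq> {}" "\<And>x. x \<in> P \<Longrightarrow> u \<bullet> x \<le> b"
  shows "\<exists>m\<le>b. attains_max P u m"
proof -
  have "\<exists>z\<in>P. \<forall>x\<in>P. u \<bullet> x \<le> u \<bullet> z"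
    using assms
  proof (induction "nat (aff_dim P + 1)" arbitrary: P rule: less_induct)
    case less
    show ?case
    proof (rule ccontr)
      assume nomax: "\<not> (\<exists>z\<in>P. \<forall>x\<in>P. u \<bullet> x \<le> u \<bullet> z)"
      have cl: "closed P" using less.prems polyhedron_imp_closed by blast
      have facet: "\<exists>F. F facet_of P \<and> (\<exists>y\<in>F. u \<bullet> x \<le> u \<bullet> y)" if x: "x \<in> P" for x
      proof -
        obtain p where p: "p \<in> P" "u \<bullet> p > u \<bullet> x" using nomax x by (meson not_le)
        define d where "d = p - x"
        have ud: "u \<bullet> d > 0" using p by (simp add: d_def inner_diff_right)
        \<comment> \<open>The parameters for which the ray from \<open>x\<close> through
          \<open>p\<close> stays in \<open>P\<close>. They are bounded because \<open>u\<close>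
          grows along the ray but stays below \<open>b\<close>; the supremum gives the exit point
          \<open>y\<close>.\<close>
        define A where "A = {t. 0 \<le> t \<and> x + t *\<^sub>R d \<in> P}"
        have A0: "0 \<in> A" using x by (simp add: A_def)
        have "A = {0..} \<inter> (\<lambda>t. x + t *\<^sub>R d) -` P" by (auto simp: A_def)
        then have clA: "closed A"
          using cl by (auto intro!: closed_Int closed_vimage continuous_intros)
        have bdA: "bdd_above A"
        proof (rule bdd_aboveI)
          fix t assume "t \<in> A"
          then have "u \<bullet> (x + t *\<^sub>R d) \<le> b" using less.prems by (auto simp: A_def)
          then show "t \<le> (b - u \<bullet> x) / (u \<bullet> d)"
            using ud by (simp add: inner_add_right field_simps)
        qed
        define t where "t = Sup A"
        have tA: "t \<in> A" unfolding t_def using clA bdA A0 by (intro closed_contains_Sup) auto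
        define y where "y = x + t *\<^sub>R d"
        have yP: "y \<in> P" using tA by (simp add: A_def y_def)
        have "y \<notin> rel_interior P"
        proof
          assume "y \<in> rel_interior P"
          then obtain e where e: "e > 0" "ball y e \<inter> affine hull P \<subseteq> P"
            by (auto simp: mem_rel_interior_ball)
          \<comment> \<open>A step of length \<open>e / 2\<close> along \<open>d\<close>: were
            \<open>y\<close> relatively interior, the ray would stay in \<open>P\<close> beyond its
            last parameter \<open>t\<close>.\<close>
          define s where "s = e / (2 * norm d)"
          have "d \<noteq> 0" using ud by auto
          then have s: "s > 0" "norm (s *\<^sub>R d) < e" using e by (auto simp: s_def)
          have "x + (t + s) *\<^sub>R d = (1 - (t + s)) *\<^sub>R x + (t + s) *\<^sub>R p"
            by (simp add: d_def algebra_simps)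
          moreover have "(1 - (t + s)) *\<^sub>R x + (t + s) *\<^sub>R p \<in> affine hull P"
            using x p by (intro mem_affine affine_affine_hull hull_inc) auto
          moreover have "x + (t + s) *\<^sub>R d = y + s *\<^sub>R d" by (simp add: y_def algebra_simps)
          moreover have "y + s *\<^sub>R d \<in> ball y e" using s by (simp add: dist_norm)
          ultimately have "x + (t + s) *\<^sub>R d \<in> P" using e by auto
          then have "t + s \<in> A" using tA s by (auto simp: A_def)
          then have "t + s \<le> t" unfolding t_def using bdA by (rule cSup_upper)
          then show False using s by simp
        qed
        then obtain F where "F facet_of P" "y \<in> F"
          using rel_boundary_of_polyhedron[OF less.prems(1)] yP by blast
        moreover have "u \<bullet> x \<le> u \<bullet> y" using tA ud by (simp add: y_def inner_add_right A_def)
        ultimately show ?thesis by blast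
      qed
      have fm: "\<exists>z\<in>F. \<forall>x\<in>F. u \<bullet> x \<le> u \<bullet> z" if F: "F facet_of P" for F
      proof (rule less.hyps)
        have ff: "F face_of P" "F \<noteq> {}" "aff_dim F = aff_dim P - 1" using F by (auto simp: facet_of_def)
        show "polyhedron F" using face_of_polyhedron_polyhedron less.prems ff by blast
        show "F \<noteq> {}" by fact
        show "\<And>x. x \<in> F \<Longrightarrow> u \<bullet> x \<le> b" using ff face_of_imp_subset less.prems by blast
        have "aff_dim F \<ge> 0" using ff by (metis aff_dim_negative_iff not_less)
        then show "nat (aff_dim F + 1) < nat (aff_dim P + 1)" using ff by simp
      qed
      then obtain z where z: "\<And>F. F facet_of P \<Longrightarrow> z F \<in> F \<and> (\<forall>x\<in>F. u \<bullet> x \<le> u \<bullet> z F)"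
        by metis
      define M where "M = (\<lambda>F. u \<bullet> z F) ` {F. F facet_of P}"
      have "finite M" using less.prems by (simp add: M_def finite_polyhedron_facets)
      moreover have "M \<noteq> {}" using facet less.prems by (auto simp: M_def)
      ultimately have "Max M \<in> M" by simp
      then obtain F where F: "F facet_of P" "Max M = u \<bullet> z F" by (auto simp: M_def)
      have "z F \<in> P" using F z facet_of_imp_subset by blast
      moreover have "u \<bullet> x \<le> u \<bullet> z F" if x: "x \<in> P" for x
      proof -
        obtain G y where "G facet_of P" "y \<in> G" "u \<bullet> x \<le> u \<bullet> y" using facet[OF x] by blast
        then have "u \<bullet> x \<le> u \<bullet> z G" "u \<bullet> z G \<in> M" using z by (force simp: M_def)+
        then show ?thesis using Max_ge[OF \<open>finite M\<close>] F by fastforce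
      qed
      ultimately show False using nomax by blast
    qed
  qed
  then obtain z where "z \<in> P" "\<forall>x\<in>P. u \<bullet> x \<le> u \<bullet> z" by blast
  then show ?thesis using assms(3) by (intro exI[of _ "u \<bullet> z"]) (auto simp: attains_max_def)
qed

text \<open>The image is an interval, so a limit point \<open>l\<close> belongs to it once there are
  values at least and at most \<open>l\<close>. If all values were below \<open>l\<close>, so would
  be their maximum, which would separate \<open>l\<close> from the image; the other side follows
  with \<open>- u\<close>.\<close>

lemma closed_inner_image_polyhedron:
  fixes P :: "'a::euclidean_space set"
  assumes "polyhedron P"
  shows "closed ((\<lambda>x. u \<bullet> x) ` P)"
proof -
  let ?J = "(\<lambda>x. u \<bullet> x) ` P"
  have lin: "linear (\<lambda>x. u \<bullet> x)" by (simp add: bounded_linear.linear bounded_linear_inner_right)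
  have "is_interval ?J"
    unfolding is_interval_convex_1
    using convex_linear_image[OF lin polyhedron_imp_convex[OF assms]] .
  then have iv: "\<And>a b x. a \<in> ?J \<Longrightarrow> b \<in> ?J \<Longrightarrow> a \<le> x \<Longrightarrow> x \<le> b \<Longrightarrow> x \<in> ?J"
    unfolding is_interval_1 by blast
  have up: "\<exists>x\<in>P. l \<le> w \<bullet> x" if "l islimpt (\<lambda>x. w \<bullet> x) ` P" for l w
  proof (rule ccontr)
    assume *: "\<not> (\<exists>x\<in>P. l \<le> w \<bullet> x)"
    have "P \<noteq> {}" using that by auto
    then obtain m where m: "m \<le> l" "attains_max P w m"
      using polyhedron_attains_max[OF assms, of w l] * by force
    then have "m < l" using * by (force simp: attains_max_def)
    then have "\<exists>y\<in>(\<lambda>x. w \<bullet> x) ` P. y \<in> {m<..}"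
      using that by (meson greaterThan_iff islimpt_def open_greaterThan)
    then show False using m by (force simp: attains_max_def)
  qed
  show ?thesis
    unfolding closed_limpt
  proof (intro allI impI)
    fix l assume l: "l islimpt ?J"
    obtain x where x: "x \<in> P" "l \<le> u \<bullet> x" using up[OF l] by blast
    have "(\<lambda>x. (-u) \<bullet> x) ` P = uminus ` ?J" by (auto simp: image_image)
    moreover have "(- l) islimpt uminus ` ?J"
      using l islimpt_isCont_image[of l ?J uminus] 
      by (simp add: eventually_at_filter)
    ultimately obtain y where y: "y \<in> P" "- l \<le> (-u) \<bullet> y" using up by metis
    show "l \<in> ?J" by (rule iv[of "u \<bullet> y" "u \<bullet> x"]) (use x y in auto)
  qed
qed

lemma attains_max_unique: "attains_max P u m \<Longrightarrow> attains_max P u m' \<Longrightarrow> m = m'"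
  unfolding attains_max_def by (metis order_antisym)

text \<open>The Euler characteristic of the slice of \<open>P i\<close> over \<open>t\<close> is the
  indicator at \<open>t\<close> of the interval of values of \<open>u\<close>. This gives a relation
  among closed intervals, whose right endpoints are the maxima.\<close>

lemma sum_attains_max_eq_0:
  fixes P :: "'i \<Rightarrow> 'a::euclidean_space set" and c :: "'i \<Rightarrow> int"
  assumes fin: "finite I" and ph: "\<And>i. i \<in> I \<Longrightarrow> polyhedron (P i)"
    and z: "\<And>x. (\<Sum>i\<in>I. c i * of_bool (x \<in> P i)) = 0"
  shows "(\<Sum>i\<in>I. c i * of_bool (attains_max (P i) u m)) = 0"
proof -
  let ?J = "\<lambda>i. (\<lambda>x. u \<bullet> x) ` P i"
  have "(\<Sum>i\<in>I. c i * of_bool (m \<in> ?J i \<and> (\<forall>y\<in>?J i. y \<le> m))) = 0"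
  proof (rule sum_of_bool_max_eq_0[OF fin])
    fix t
    have "(\<Sum>i\<in>I. c i * of_bool (P i \<inter> {x. u \<bullet> x = t} \<noteq> {})) = 0"
    proof (rule sum_of_bool_nonempty_eq_0[OF fin])
      fix x
      have "(\<Sum>i\<in>I. c i * of_bool (x \<in> P i \<inter> {x. u \<bullet> x = t}))
          = (\<Sum>i\<in>I. c i * of_bool (x \<in> P i)) * of_bool (u \<bullet> x = t)"
        unfolding sum_distrib_right by (rule sum.cong) auto
      then show "(\<Sum>i\<in>I. c i * of_bool (x \<in> P i \<inter> {x. u \<bullet> x = t})) = 0" using z by simp
    qed (use ph in \<open>auto simp: polyhedron_hyperplane intro!: polyhedron_imp_closed polyhedron_imp_convex\<close>)
    moreover have "P i \<inter> {x. u \<bullet> x = t} \<noteq> {} \<longleftrightarrow> t \<in> ?J i" for i by auto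
    ultimately show "(\<Sum>i\<in>I. c i * of_bool (t \<in> ?J i)) = 0" by simp
  next
    fix i assume i: "i \<in> I"
    show "closed (?J i)" by (rule closed_inner_image_polyhedron[OF ph[OF i]])
    have "linear (\<lambda>x. u \<bullet> x)" by (simp add: bounded_linear.linear bounded_linear_inner_right)
    then show "convex (?J i)"
      by (rule convex_linear_image[OF _ polyhedron_imp_convex[OF ph[OF i]]])
  qed
  moreover have "(m \<in> ?J i \<and> (\<forall>y\<in>?J i. y \<le> m)) \<longleftrightarrow> attains_max (P i) u m" for i
    by (auto simp: attains_max_def)
  ultimately show ?thesis by simp
qed

text \<open>For nonempty \<open>P i\<close>, membership \<open>u \<in> W i\<close> says that
  \<open>u\<close> has a maximum of at most \<open>u \<bullet> x - 1\<close> on \<open>P i\<close>.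
  So the relation among maxima passes to the sets \<open>W i\<close>, and their Euler
  characteristics detect which \<open>P i\<close> miss \<open>x\<close>.\<close>

lemma sum_of_bool_mem_eq_0:
  fixes P :: "'i \<Rightarrow> 'a::euclidean_space set" and c :: "'i \<Rightarrow> int"
  assumes fin: "finite I" and ph: "\<And>i. i \<in> I \<Longrightarrow> polyhedron (P i)"
    and z: "\<And>u m. (\<Sum>i\<in>I. c i * of_bool (attains_max (P i) u m)) = 0"
  shows "(\<Sum>i\<in>I. c i * of_bool (x \<in> P i)) = 0"
proof -
  define I' where "I' = {i\<in>I. P i \<noteq> {}}"
  have fin': "finite I'" and I': "I' \<subseteq> I" using fin by (auto simp: I'_def)
  have red: "(\<Sum>i\<in>I'. c i * of_bool (\<phi> i)) = (\<Sum>i\<in>I. c i * of_bool (\<phi> i))"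
    if "\<And>i. P i = {} \<Longrightarrow> \<not> \<phi> i" for \<phi>
    by (rule sum.mono_neutral_left) (use fin that in \<open>auto simp: I'_def\<close>)
  have z': "(\<Sum>i\<in>I'. c i * of_bool (attains_max (P i) u m)) = 0" for u m
    using z[of u m] by (subst red) (auto simp: attains_max_def)
  \<comment> \<open>The functional 0 has maximum 0 on every nonempty set, so the hypothesis at
    \<open>(0, 0)\<close> gives the total of the coefficients; at the end this turns non-membership
    into membership.\<close>
  have zn: "(\<Sum>i\<in>I'. c i) = 0"
  proof -
    have "attains_max (P i) 0 0" if "i \<in> I'" for i
      using that by (auto simp: attains_max_def I'_def)
    then show ?thesis using z'[of 0 0] by simp
  qed
  define W where "W i = {u. \<forall>p\<in>P i. u \<bullet> (p - x) \<le> -1}" for i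
  have "(\<Sum>i\<in>I'. c i * of_bool (W i \<noteq> {})) = 0"
  proof (rule sum_of_bool_nonempty_eq_0[OF fin'])
    fix i
    have W: "W i = (\<Inter>p\<in>P i. {u. (p - x) \<bullet> u \<le> -1})" by (auto simp: W_def inner_commute)
    show "closed (W i)" unfolding W by (intro closed_INT ballI closed_halfspace_le)
    show "convex (W i)" unfolding W by (intro convex_INT convex_halfspace_le)
  next
    fix u
    \<comment> \<open>Each \<open>P i\<close> has at most one maximal value of \<open>u\<close>, so
      only finitely many \<open>m\<close> occur, and at most one of them counts for a given
      \<open>i\<close>.\<close>
    define M where "M = {m. m \<le> u \<bullet> x - 1 \<and> (\<exists>i\<in>I'. attains_max (P i) u m)}"
    have "M \<subseteq> (\<lambda>i. THE m. attains_max (P i) u m) ` I'"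
    proof
      fix m assume "m \<in> M"
      then obtain i where i: "i \<in> I'" "attains_max (P i) u m" by (auto simp: M_def)
      then have "(THE m. attains_max (P i) u m) = m"
        using attains_max_unique by (intro the_equality) auto
      then show "m \<in> (\<lambda>i. THE m. attains_max (P i) u m) ` I'" using i by blast
    qed
    then have finM: "finite M" using fin' finite_subset by blast
    have "(\<Sum>i\<in>I'. c i * of_bool (u \<in> W i)) = (\<Sum>i\<in>I'. \<Sum>m\<in>M. c i * of_bool (attains_max (P i) u m))"
    proof (rule sum.cong[OF refl])
      fix i assume i: "i \<in> I'"
      show "c i * of_bool (u \<in> W i) = (\<Sum>m\<in>M. c i * of_bool (attains_max (P i) u m))"
      proof (cases "u \<in> W i")
        case True
        have "\<And>p. p \<in> P i \<Longrightarrow> u \<bullet> p \<le> u \<bullet> x - 1" using True by (force simp: W_def algebra_simps)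
        moreover have "polyhedron (P i)" "P i \<noteq> {}" using i ph by (auto simp: I'_def)
        ultimately obtain m where m: "m \<le> u \<bullet> x - 1" "attains_max (P i) u m"
          using polyhedron_attains_max by blast
        then have "m \<in> M" using i by (auto simp: M_def)
        have "(\<Sum>m'\<in>M. c i * of_bool (attains_max (P i) u m')) = (\<Sum>m'\<in>M. if m' = m then c i else 0)"
          by (rule sum.cong) (use m attains_max_unique in auto)
        then show ?thesis using True finM \<open>m \<in> M\<close> by simp
      next
        case False
        have "\<not> attains_max (P i) u m" if "m \<in> M" for m
          using that False unfolding M_def W_def attains_max_def by (force simp: algebra_simps)
        then show ?thesis using False by simp
      qed
    qed
    also have "\<dots> = (\<Sum>m\<in>M. \<Sum>i\<in>I'. c i * of_bool (attains_max (P i) u m))" by (rule sum.swap)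
    finally show "(\<Sum>i\<in>I'. c i * of_bool (u \<in> W i)) = 0" using z' by simp
  qed
  moreover have "W i \<noteq> {} \<longleftrightarrow> x \<notin> P i" if "i \<in> I'" for i
  proof
    assume "W i \<noteq> {}"
    then show "x \<notin> P i" by (force simp: W_def)
  next
    assume "x \<notin> P i"
    moreover have "closed (P i)" "convex (P i)"
      using that ph by (auto simp: I'_def polyhedron_imp_closed polyhedron_imp_convex)
    ultimately obtain a b where ab: "a \<bullet> x < b" "\<forall>p\<in>P i. b < a \<bullet> p"
      using separating_hyperplane_closed_point[of "P i" x] by blast
    \<comment> \<open>The separating functional is reversed and rescaled so that the gap
      \<open>b - a \<bullet> x\<close> becomes 1.\<close>
    have "(- (1 / (b - a \<bullet> x)) *\<^sub>R a) \<bullet> (p - x) \<le> -1" if "p \<in> P i" for p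
    proof -
      have "b - a \<bullet> x \<le> a \<bullet> (p - x)" using ab that by (auto simp: algebra_simps less_imp_le)
      then show ?thesis using ab by (simp add: divide_simps)
    qed
    then show "W i \<noteq> {}" unfolding W_def by blast
  qed
  ultimately have "(\<Sum>i\<in>I'. c i * of_bool (x \<notin> P i)) = 0" by (simp cong: sum.cong)
  moreover have "(\<Sum>i\<in>I'. c i * of_bool (x \<in> P i)) + (\<Sum>i\<in>I'. c i * of_bool (x \<notin> P i)) = (\<Sum>i\<in>I'. c i)"
    unfolding sum.distrib[symmetric] by (rule sum.cong) auto
  ultimately have "(\<Sum>i\<in>I'. c i * of_bool (x \<in> P i)) = 0" using zn by simp
  then show ?thesis by (subst (asm) red) auto
qed

section \<open>Faces, normal cones and tangent cones\<close>

definition max_face :: "'a::euclidean_space set \<Rightarrow> 'a \<Rightarrow> 'a set" where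
  "max_face P u = {x\<in>P. \<forall>y\<in>P. u \<bullet> y \<le> u \<bullet> x}"

lemma max_face_subset: "max_face P u \<subseteq> P"
  by (auto simp: max_face_def)

lemma max_face_face_of:
  assumes "convex P"
  shows "max_face P u face_of P"
proof (cases "max_face P u = {}")
  case False
  then obtain z where z: "z \<in> P" "\<forall>y\<in>P. u \<bullet> y \<le> u \<bullet> z" by (auto simp: max_face_def)
  then have "max_face P u = P \<inter> {x. u \<bullet> x = u \<bullet> z}"
    by (force simp: max_face_def)
  then show ?thesis using face_of_Int_supporting_hyperplane_le[OF assms, of u "u \<bullet> z"] z by auto
qed auto

text \<open>Faces of a polyhedron are exposed by supporting hyperplanes; since \<open>F\<close> is
  nonempty, the bound \<open>b\<close> is attained, so \<open>F\<close> consists of all the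
  maximisers.\<close>

lemma exposed_by:
  assumes "polyhedron P" "F face_of P" "F \<noteq> {}"
  obtains u where "max_face P u = F"
proof -
  obtain a b where ab: "P \<subseteq> {x. a \<bullet> x \<le> b}" "F = P \<inter> {x. a \<bullet> x = b}"
    using exposed_face_of_polyhedron[OF assms(1)] assms(2) unfolding exposed_face_of_def by metis
  moreover obtain z where "z \<in> F" using assms by blast
  ultimately have "max_face P a = F" by (force simp: max_face_def)
  then show thesis by (rule that)
qed

lemma mem_normal_cone_iff: "F \<subseteq> P \<Longrightarrow> u \<in> normal_cone P F \<longleftrightarrow> F \<subseteq> max_face P u"
  by (auto simp: normal_cone_def max_face_def)

lemma normal_cone_antimono: "F \<subseteq> G \<Longrightarrow> normal_cone P G \<subseteq> normal_cone P F"
  by (auto simp: normal_cone_def)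

lemma max_face_self: "u \<in> normal_cone P (max_face P u)"
  by (auto simp: normal_cone_def max_face_def)

section \<open>Tangent cones and their duality with normal cones\<close>

lemma rel_interior_prolong:
  fixes F :: "'a::euclidean_space set"
  assumes "convex F" "x \<in> rel_interior F" "f \<in> F"
  obtains e where "e > 0" "x + e *\<^sub>R (x - f) \<in> F"
proof -
  obtain m where m: "m > 1" "(1 - m) *\<^sub>R f + m *\<^sub>R x \<in> F"
    using convex_rel_interior_iff[OF assms(1)] assms by blast
  show thesis
    by (rule that[of "m - 1"]) (use m in \<open>auto simp: algebra_simps\<close>)
qed

text \<open>Other base points \<open>f \<in> F\<close> add no directions: extending the segment from
  \<open>f\<close> past \<open>x\<close> to \<open>g \<in> F\<close> and mixing \<open>g\<close>
  with \<open>q\<close> gives \<open>p \<in> Q\<close> with \<open>p - x\<close> a positive multiple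
  of \<open>q - f\<close>.\<close>

lemma tangent_cone_at_rel_interior:
  fixes Q :: "'a::euclidean_space set"
  assumes "convex Q" "F face_of Q" "x \<in> rel_interior F"
  shows "tangent_cone Q F = {l *\<^sub>R (q - x) | l q. l \<ge> 0 \<and> q \<in> Q}" (is "_ = ?R")
proof
  have FQ: "F \<subseteq> Q" by (rule face_of_imp_subset[OF assms(2)])
  have cF: "convex F" by (rule face_of_imp_convex[OF assms(2)])
  have xF: "x \<in> F" using assms(3) rel_interior_subset by blast
  then have xQ: "x \<in> Q" using FQ by blast
  have cone: "convex_cone ?R"
    unfolding convex_cone_iff
  proof (intro conjI ballI allI impI)
    have "0 = 0 *\<^sub>R (x - x)" by simp
    then show "0 \<in> ?R" using xQ by blast
  next
    fix y z assume "y \<in> ?R" "z \<in> ?R"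
    then obtain l q m r where *: "y = l *\<^sub>R (q - x)" "z = m *\<^sub>R (r - x)" "l \<ge> 0" "m \<ge> 0" "q \<in> Q" "r \<in> Q"
      by blast
    show "y + z \<in> ?R"
    proof (cases "l + m = 0")
      case True
      then have "y + z = 0 *\<^sub>R (x - x)" using * by (simp add: add_nonneg_eq_0_iff)
      then show ?thesis using xQ by blast
    next
      case False
      define s where "s = l + m"
      have s: "s > 0" using False * by (simp add: s_def)
      define p where "p = (l / s) *\<^sub>R q + (m / s) *\<^sub>R r"
      have "p \<in> Q" unfolding p_def
        by (rule convexD[OF assms(1)]) (use * s in \<open>auto simp: s_def add_divide_distrib[symmetric]\<close>)
      moreover have "y + z = s *\<^sub>R (p - x)"
        using s * by (simp add: p_def scaleR_diff_right scaleR_add_right) (simp add: s_def algebra_simps)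
      ultimately show ?thesis using s by (auto intro: less_imp_le)
    qed
  next
    fix y and c :: real assume "y \<in> ?R" "c \<ge> 0"
    then obtain l q where *: "y = l *\<^sub>R (q - x)" "l \<ge> 0" "q \<in> Q" by blast
    then have "c *\<^sub>R y = (c * l) *\<^sub>R (q - x)" "c * l \<ge> 0" using \<open>c \<ge> 0\<close> by auto
    then show "c *\<^sub>R y \<in> ?R" using * by blast
  qed
  show "tangent_cone Q F \<subseteq> ?R"
    unfolding tangent_cone_def
  proof (rule hull_minimal[of _ _ convex_cone])
    show "{v' - v |v v'. v \<in> F \<and> v' \<in> Q} \<subseteq> ?R"
    proof clarify
      fix f q assume f: "f \<in> F" and q: "q \<in> Q"
      obtain e where e: "e > 0" "x + e *\<^sub>R (x - f) \<in> F"
        using rel_interior_prolong[OF cF assms(3) f] by blast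
      define g where "g = x + e *\<^sub>R (x - f)"
      \<comment> \<open>The solution of \<open>(1 - d) * e = d\<close>, for which the terms in
        \<open>x\<close> cancel and \<open>p - x\<close> becomes
        \<open>d *\<^sub>R (q - f)\<close>.\<close>
      define d where "d = e / (1 + e)"
      define p where "p = (1 - d) *\<^sub>R g + d *\<^sub>R q"
      have d: "d > 0" "d < 1" "(1 - d) * e = d" using e by (auto simp: d_def field_simps)
      have "p \<in> Q" unfolding p_def
        by (rule convexD[OF assms(1)]) (use d e q FQ in \<open>auto simp: g_def\<close>)
      moreover have "q - f = (1 / d) *\<^sub>R (p - x)"
      proof -
        have "p - x = ((1 - d) * e) *\<^sub>R (x - f) + d *\<^sub>R (q - x)"
          by (simp add: p_def g_def algebra_simps)
        also have "\<dots> = d *\<^sub>R (q - f)" unfolding d(3) by (simp add: algebra_simps)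
        finally show ?thesis using d by simp
      qed
      moreover have "1 / d \<ge> 0" using d by simp
      ultimately show "\<exists>l qa. q - f = l *\<^sub>R (qa - x) \<and> 0 \<le> l \<and> qa \<in> Q" by blast
    qed
  qed (rule cone)
  show "?R \<subseteq> tangent_cone Q F"
  proof clarify
    fix l :: real and q assume "0 \<le> l" "q \<in> Q"
    moreover from this have "q - x \<in> tangent_cone Q F"
      unfolding tangent_cone_def by (intro hull_inc) (use xF in blast)
    ultimately show "l *\<^sub>R (q - x) \<in> tangent_cone Q F"
      unfolding tangent_cone_def by (simp add: convex_cone_hull_mul)
  qed
qed

lemma tangent_cone_polar:
  assumes "w \<in> normal_cone Q F" "y \<in> tangent_cone Q F"
  shows "w \<bullet> y \<le> 0"
proof -
  have "tangent_cone Q F \<subseteq> {y. w \<bullet> y \<le> 0}"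
    unfolding tangent_cone_def
  proof (rule hull_minimal[of _ _ convex_cone])
    show "{v' - v |v v'. v \<in> F \<and> v' \<in> Q} \<subseteq> {y. w \<bullet> y \<le> 0}"
      using assms by (auto simp: normal_cone_def inner_diff_right)
    show "convex_cone {y. w \<bullet> y \<le> 0}"
      unfolding convex_cone_iff by (auto simp: inner_add_right mult_nonneg_nonpos)
  qed
  then show ?thesis using assms by blast
qed

text \<open>Near a relative interior point \<open>x\<close> of \<open>F\<close> only the
  inequalities active at \<open>x\<close> restrict \<open>Q\<close>, so they cut out the tangent
  cone. Being active on all of \<open>F\<close>, they have their normals in the normal cone.\<close>

lemma tangent_cone_halfspaces:
  fixes Q :: "'a::euclidean_space set"
  assumes "polyhedron Q" "F face_of Q" "F \<noteq> {}"
  shows "\<exists>A. finite A \<and> A \<subseteq> normal_cone Q F \<and> tangent_cone Q F = {y. \<forall>a\<in>A. a \<bullet> y \<le> 0}"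
proof -
  have cQ: "convex Q" using assms polyhedron_imp_convex by blast
  have FQ: "F \<subseteq> Q" by (rule face_of_imp_subset[OF assms(2)])
  have cF: "convex F" by (rule face_of_imp_convex[OF assms(2)])
  obtain x where x: "x \<in> rel_interior F" using assms cF rel_interior_eq_empty by blast
  then have xF: "x \<in> F" using rel_interior_subset by blast
  obtain H where H: "finite H" "Q = \<Inter>H" "\<And>h. h \<in> H \<Longrightarrow> \<exists>a b. h = {x. a \<bullet> x \<le> b}"
    using assms(1) unfolding polyhedron_def by metis
  obtain a b where ab: "\<And>h. h \<in> H \<Longrightarrow> h = {x. a h \<bullet> x \<le> b h}" using H(3) by metis
  have Qab: "y \<in> Q \<longleftrightarrow> (\<forall>h\<in>H. a h \<bullet> y \<le> b h)" for y using H(2) ab by blast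
  define A where "A = a ` {h\<in>H. a h \<bullet> x = b h}"
  have AN: "A \<subseteq> normal_cone Q F"
  proof
    fix v assume "v \<in> A"
    then obtain h where h: "h \<in> H" "v = a h" "a h \<bullet> x = b h" by (auto simp: A_def)
    \<comment> \<open>Were the inequality strict at \<open>f\<close>, the segment from
      \<open>f\<close> through \<open>x\<close> would leave \<open>Q\<close> right after
      \<open>x\<close>, although it continues inside \<open>F\<close>.\<close>
    have "v \<bullet> f \<ge> b h" if f: "f \<in> F" for f
    proof -
      obtain e where e: "e > 0" "x + e *\<^sub>R (x - f) \<in> F"
        using rel_interior_prolong[OF cF x f] by blast
      then have "a h \<bullet> (x + e *\<^sub>R (x - f)) \<le> b h" using FQ Qab h by blast
      then have "e * (b h - a h \<bullet> f) \<le> 0" using h by (simp add: inner_add_right inner_diff_right)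
      then show ?thesis using e h by (simp add: mult_le_0_iff)
    qed
    then show "v \<in> normal_cone Q F"
      unfolding normal_cone_def using Qab h order_trans by blast
  qed
  have "y \<in> tangent_cone Q F" if y: "\<forall>v\<in>A. v \<bullet> y \<le> 0" for y
  proof -
    \<comment> \<open>For small \<open>e > 0\<close> the active inequalities hold by the assumption
      on \<open>y\<close>, the others by continuity at \<open>x\<close>.\<close>
    have "\<forall>\<^sub>F e in at_right 0. \<forall>h\<in>H. a h \<bullet> (x + e *\<^sub>R y) \<le> b h"
    proof (rule eventually_ball_finite[OF H(1)], rule ballI)
      fix h assume h: "h \<in> H"
      show "\<forall>\<^sub>F e in at_right 0. a h \<bullet> (x + e *\<^sub>R y) \<le> b h"
      proof (cases "a h \<bullet> x = b h")
        case True
        have "\<forall>\<^sub>F e in at_right 0. (e::real) > 0" by (simp add: eventually_at_right_less)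
        then show ?thesis
          by eventually_elim (use True y h in \<open>auto simp: A_def inner_add_right mult_nonneg_nonpos\<close>)
      next
        case False
        then have "a h \<bullet> x < b h" using xF FQ Qab h by force
        moreover have "((\<lambda>e. a h \<bullet> (x + e *\<^sub>R y)) \<longlongrightarrow> a h \<bullet> (x + 0 *\<^sub>R y)) (at_right 0)"
          by (intro tendsto_intros)
        ultimately have "\<forall>\<^sub>F e in at_right 0. a h \<bullet> (x + e *\<^sub>R y) < b h"
          by (auto intro: order_tendstoD)
        then show ?thesis by eventually_elim simp
      qed
    qed
    moreover have "\<forall>\<^sub>F e in at_right 0. (e::real) > 0" by (simp add: eventually_at_right_less)
    ultimately have "\<forall>\<^sub>F e in at_right 0. (e::real) > 0 \<and> (\<forall>h\<in>H. a h \<bullet> (x + e *\<^sub>R y) \<le> b h)"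
      by eventually_elim simp
    then have "\<exists>e. (e::real) > 0 \<and> (\<forall>h\<in>H. a h \<bullet> (x + e *\<^sub>R y) \<le> b h)"
      by (rule eventually_happens'[rotated]) simp
    then obtain e where e: "e > 0" "x + e *\<^sub>R y \<in> Q"
      using Qab by blast
    have "y = (1 / e) *\<^sub>R ((x + e *\<^sub>R y) - x)" "1 / e \<ge> 0" using e by auto
    then show ?thesis
      unfolding tangent_cone_at_rel_interior[OF cQ assms(2) x] using e by blast
  qed
  then have "tangent_cone Q F = {y. \<forall>a\<in>A. a \<bullet> y \<le> 0}"
    using AN tangent_cone_polar by blast
  then show ?thesis using AN H(1) by (intro exI[of _ A]) (simp add: A_def)
qed

text \<open>Finitely many elements of the normal cone already cut out the tangent cone, and all
  others are nonpositive on it.\<close>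

lemma tangent_cone_eq_polar:
  fixes Q :: "'a::euclidean_space set"
  assumes "polyhedron Q" "F face_of Q" "F \<noteq> {}"
  shows "tangent_cone Q F = {y. \<forall>w\<in>normal_cone Q F. w \<bullet> y \<le> 0}"
proof -
  obtain A where A: "A \<subseteq> normal_cone Q F" "tangent_cone Q F = {y. \<forall>a\<in>A. a \<bullet> y \<le> 0}"
    using tangent_cone_halfspaces[OF assms] by (elim exE conjE)
  then have "{y. \<forall>w\<in>normal_cone Q F. w \<bullet> y \<le> 0} \<subseteq> tangent_cone Q F" by blast
  then show ?thesis using tangent_cone_polar by blast
qed

lemma lineal_tangent_cone:
  fixes Q :: "'a::euclidean_space set"
  assumes "polyhedron Q" "F face_of Q" "F \<noteq> {}"
  shows "lineal (tangent_cone Q F) = {y. \<forall>w\<in>normal_cone Q F. w \<bullet> y = 0}"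
proof -
  have "y \<in> uminus ` C \<longleftrightarrow> - y \<in> C" for y :: 'a and C
    by (metis image_iff minus_minus)
  then show ?thesis
    unfolding lineal_def tangent_cone_eq_polar[OF assms] by (force intro: order_antisym)
qed

lemma convex_cone_tangent_cone: "convex_cone (tangent_cone Q F)"
  unfolding tangent_cone_def by (rule convex_cone_convex_cone_hull)

lemma mem_translation_iff: "x \<in> (\<lambda>y. y + v) ` C \<longleftrightarrow> x - v \<in> C" for v :: "'a::ab_group_add"
  by (auto intro: image_eqI[of _ _ "x - v"])

section \<open>Tight containment\<close>

lemma polyhedron_tangent_cone_translate:
  fixes Q :: "'a::euclidean_space set"
  assumes "polyhedron Q" "F face_of Q" "F \<noteq> {}"
  shows "polyhedron ((\<lambda>x. x + v) ` tangent_cone Q F)"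
proof -
  obtain A where A: "finite A" "tangent_cone Q F = {y. \<forall>a\<in>A. a \<bullet> y \<le> 0}"
    using tangent_cone_halfspaces[OF assms] by (elim exE conjE)
  have "(\<lambda>x. x + v) ` tangent_cone Q F = \<Inter>((\<lambda>a. {y. a \<bullet> y \<le> a \<bullet> v}) ` A)"
    unfolding set_eq_iff mem_translation_iff A(2) by (auto simp: inner_diff_right)
  then show ?thesis using A(1) by (auto simp: polyhedron_halfspace_le)
qed

text \<open>This makes the representation chosen in \<open>tightly_contains\<close> immaterial. Both
  \<open>v - v'\<close> and \<open>v' - v\<close> lie in both cones, and adding them carries each
  cone into the other.\<close>

lemma convex_cone_translation_eqD:
  fixes C C' :: "'a::euclidean_space set"
  assumes C: "convex_cone C" and C': "convex_cone C'"
    and eq: "(\<lambda>x. x + v) ` C = (\<lambda>x. x + v') ` C'"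
  shows "C = C'" "v - v' \<in> lineal C"
proof -
  have iff: "x - v \<in> C \<longleftrightarrow> x - v' \<in> C'" for x
    using eq mem_translation_iff by metis
  have a': "v - v' \<in> C'" using iff[of v] C convex_cone_contains_0 by auto
  have b: "v' - v \<in> C" using iff[of v'] C' convex_cone_contains_0 by auto
  \<comment> \<open>Doubling helps because \<open>v + 2 *\<^sub>R (v' - v)\<close> lies in the first
    translate and its offset from \<open>v'\<close> is \<open>v' - v\<close>.\<close>
  have "2 *\<^sub>R (v' - v) \<in> C" using b C convex_cone_iff by fastforce
  then have b': "v' - v \<in> C'" using iff[of "v + 2 *\<^sub>R (v' - v)"] by (simp add: algebra_simps scaleR_2)
  have "2 *\<^sub>R (v - v') \<in> C'" using a' C' convex_cone_iff by fastforce
  then have a: "v - v' \<in> C" using iff[of "v' + 2 *\<^sub>R (v - v')"] by (simp add: algebra_simps scaleR_2)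
  have "x \<in> C'" if "x \<in> C" for x
  proof -
    have "x + v - v' \<in> C'" using iff[of "x + v"] that by simp
    then have "(x + v - v') + (v' - v) \<in> C'" using b' C' convex_cone_add by blast
    then show ?thesis by simp
  qed
  moreover have "x \<in> C" if "x \<in> C'" for x
  proof -
    have "x + v' - v \<in> C" using iff[of "x + v'"] that by simp
    then have "(x + v' - v) + (v - v') \<in> C" using a C convex_cone_add by blast
    then show ?thesis by simp
  qed
  ultimately show "C = C'" by blast
  have "v - v' \<in> uminus ` C" using b by (auto intro: image_eqI[of _ _ "v' - v"])
  then show "v - v' \<in> lineal C" using a by (simp add: lineal_def)
qed

lemma mem_normal_cone_sing: "w \<in> normal_cone P {x} \<longleftrightarrow> (\<forall>p\<in>P. w \<bullet> p \<le> w \<bullet> x)"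
  by (simp add: normal_cone_def)

lemma tran_iff:
  "T \<in> tran Q \<longleftrightarrow> (\<exists>F v. F face_of Q \<and> F \<noteq> {} \<and> T = (\<lambda>x. x + v) ` tangent_cone Q F)"
  by (auto simp: tran_def tangent_cones_def)

lemma tangent_cone_translate_cong:
  fixes Q :: "'a::euclidean_space set"
  assumes "polyhedron Q" "F face_of Q" "F \<noteq> {}"
    and "\<forall>w\<in>normal_cone Q F. w \<bullet> v = w \<bullet> v'"
  shows "(\<lambda>x. x + v) ` tangent_cone Q F = (\<lambda>x. x + v') ` tangent_cone Q F"
  using assms(4) by (auto simp: set_eq_iff mem_translation_iff tangent_cone_eq_polar[OF assms(1-3)] inner_diff_right)

text \<open>Containment bounds each \<open>w\<close> of the normal cone on \<open>P\<close> by
  \<open>w \<bullet> v\<close>, and a point in the lineality part attains all these bounds at once.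
  Tight containment thus becomes a statement about maxima, with \<open>v\<close> entering only
  through its values on the normal cone.\<close>

lemma tightly_contains_iff:
  fixes Q :: "'a::euclidean_space set"
  assumes "polyhedron Q" "F face_of Q" "F \<noteq> {}"
  shows "tightly_contains Q ((\<lambda>x. x + v) ` tangent_cone Q F) P \<longleftrightarrow>
    (\<exists>x\<in>P. normal_cone Q F \<subseteq> normal_cone P {x} \<and> (\<forall>w\<in>normal_cone Q F. w \<bullet> x = w \<bullet> v))"
    (is "?L \<longleftrightarrow> ?R")
proof
  assume ?L
  then obtain C v' where C: "C \<in> tangent_cones Q"
      "(\<lambda>x. x + v) ` tangent_cone Q F = (\<lambda>x. x + v') ` C"
      "P \<subseteq> (\<lambda>x. x + v') ` C" "P \<inter> (\<lambda>x. x + v') ` lineal C \<noteq> {}"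
    unfolding tightly_contains_def by metis
  have "convex_cone C" using C(1) convex_cone_tangent_cone by (auto simp: tangent_cones_def)
  from convex_cone_translation_eqD[OF convex_cone_tangent_cone this C(2)]
  have CF: "C = tangent_cone Q F" and vv: "v - v' \<in> lineal (tangent_cone Q F)" by auto
  obtain x where x: "x \<in> P" "x - v' \<in> lineal C" using C(4) mem_translation_iff by blast
  have xv: "w \<bullet> x = w \<bullet> v'" "w \<bullet> v = w \<bullet> v'" if "w \<in> normal_cone Q F" for w
    using x(2) vv that unfolding CF lineal_tangent_cone[OF assms] by (auto simp: inner_diff_right)
  have "w \<bullet> p \<le> w \<bullet> v'" if "w \<in> normal_cone Q F" "p \<in> P" for w p
  proof -
    have "p - v' \<in> tangent_cone Q F" using C(3) that mem_translation_iff unfolding CF by blast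
    then show ?thesis using tangent_cone_polar that by (fastforce simp: inner_diff_right)
  qed
  then show ?R using x(1) xv by (auto simp: mem_normal_cone_sing intro!: bexI[of _ x])
next
  assume ?R
  then obtain x where x: "x \<in> P" "normal_cone Q F \<subseteq> normal_cone P {x}"
      "\<forall>w\<in>normal_cone Q F. w \<bullet> x = w \<bullet> v" by blast
  have "P \<subseteq> (\<lambda>x. x + v) ` tangent_cone Q F"
    using x(2,3) by (auto simp: mem_translation_iff tangent_cone_eq_polar[OF assms] inner_diff_right
        mem_normal_cone_sing subset_iff)
  moreover have "x \<in> (\<lambda>x. x + v) ` lineal (tangent_cone Q F)"
    using x(3) by (auto simp: mem_translation_iff lineal_tangent_cone[OF assms] inner_diff_right)
  ultimately show ?L
    unfolding tightly_contains_def tangent_cones_def using x(1) assms by blast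
qed

text \<open>Two points of \<open>P\<close> that maximise every functional of the normal cone agree
  on all of them, hence define the same translate. So each face has at most one tight
  translate.\<close>

lemma tightly_contains_unique:
  fixes Q :: "'a::euclidean_space set"
  assumes "polyhedron Q" "F face_of Q" "F \<noteq> {}"
    and t: "tightly_contains Q ((\<lambda>x. x + v) ` tangent_cone Q F) P"
    and x: "x \<in> P" "normal_cone Q F \<subseteq> normal_cone P {x}"
  shows "(\<lambda>x. x + v) ` tangent_cone Q F = (\<lambda>y. y + x) ` tangent_cone Q F"
proof (rule tangent_cone_translate_cong[OF assms(1-3)])
  obtain z where "z \<in> P" "normal_cone Q F \<subseteq> normal_cone P {z}" "\<forall>w\<in>normal_cone Q F. w \<bullet> z = w \<bullet> v"
    using t unfolding tightly_contains_iff[OF assms(1-3)] by blast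
  then show "\<forall>w\<in>normal_cone Q F. w \<bullet> v = w \<bullet> x"
    using x unfolding subset_iff mem_normal_cone_sing by (metis order_antisym)
qed

text \<open>There is at most one translate per face, represented by the chosen point
  \<open>z F\<close>, and a polyhedron has finitely many faces.\<close>

lemma finite_tightly_contains:
  fixes Q :: "'a::euclidean_space set"
  assumes "polyhedron Q"
  shows "finite {T\<in>tran Q. tightly_contains Q T P}"
proof -
  define z where "z F = (SOME x. x \<in> P \<and> normal_cone Q F \<subseteq> normal_cone P {x})" for F
  have "{T\<in>tran Q. tightly_contains Q T P} \<subseteq> (\<lambda>F. (\<lambda>y. y + z F) ` tangent_cone Q F) ` {F. F face_of Q}"
  proof clarify
    fix T assume "T \<in> tran Q" and t: "tightly_contains Q T P"
    then obtain F v where F: "F face_of Q" "F \<noteq> {}" "T = (\<lambda>x. x + v) ` tangent_cone Q F"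
      by (auto simp: tran_iff)
    have "\<exists>x. x \<in> P \<and> normal_cone Q F \<subseteq> normal_cone P {x}"
      using t unfolding F(3) tightly_contains_iff[OF assms F(1,2)] by blast
    then have "z F \<in> P \<and> normal_cone Q F \<subseteq> normal_cone P {z F}" unfolding z_def by (rule someI_ex)
    then have "T = (\<lambda>y. y + z F) ` tangent_cone Q F"
      using tightly_contains_unique[OF assms F(1,2)] t F(3) by blast
    then show "T \<in> (\<lambda>F. (\<lambda>y. y + z F) ` tangent_cone Q F) ` {F. F face_of Q}" using F(1) by blast
  qed
  then show ?thesis using finite_polyhedron_faces[OF assms] finite_subset by blast
qed

lemma Fimg_apply:
  assumes "finite {T\<in>tran Q. tightly_contains Q T P}"
  shows "Fimg Q P T = of_bool (T \<in> tran Q \<and> tightly_contains Q T P)"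
  using assms unfolding Fimg_def basis_e_def by (simp add: sum.delta')

section \<open>Maxima and tight containment for members of \<open>DefPlus Q\<close>\<close>

lemma DefPlus_polyhedron: "P \<in> DefPlus Q \<Longrightarrow> polyhedron P"
  by (simp add: DefPlus_def)

text \<open>Among the cones of \<open>normal_fan Q\<close> whose union is the normal cone of
  \<open>P\<close> at the face exposed by \<open>u\<close>, one contains \<open>u\<close>. It
  belongs to a face \<open>G\<close> inside the face of \<open>Q\<close> exposed by
  \<open>u\<close>, and normal cones reverse inclusion.\<close>

lemma DefPlus_max_face:
  assumes "polyhedron Q" "P \<in> DefPlus Q" "x \<in> max_face P u"
  shows "max_face Q u \<noteq> {}" "normal_cone Q (max_face Q u) \<subseteq> normal_cone P {x}"
proof -
  have "max_face P u face_of P"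
    using assms DefPlus_polyhedron polyhedron_imp_convex max_face_face_of by blast
  then have "normal_cone P (max_face P u) \<in> normal_fan P"
    using assms(3) by (auto simp: normal_fan_def)
  then obtain S where S: "S \<subseteq> normal_fan Q" "normal_cone P (max_face P u) = \<Union>S"
    using assms(2) unfolding DefPlus_def by blast
  then obtain N where N: "N \<in> S" "u \<in> N" using max_face_self by blast
  then obtain G where G: "G face_of Q" "G \<noteq> {}" "N = normal_cone Q G"
    using S(1) by (auto simp: normal_fan_def)
  have GF: "G \<subseteq> max_face Q u" using mem_normal_cone_iff[OF face_of_imp_subset[OF G(1)]] N G(3) by blast
  then show "max_face Q u \<noteq> {}" using G(2) by blast
  have "normal_cone Q (max_face Q u) \<subseteq> normal_cone Q G" using GF by (rule normal_cone_antimono)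
  also have "\<dots> \<subseteq> normal_cone P (max_face P u)" using S(2) N G(3) by blast
  also have "\<dots> \<subseteq> normal_cone P {x}" using assms(3) by (intro normal_cone_antimono) simp
  finally show "normal_cone Q (max_face Q u) \<subseteq> normal_cone P {x}" .
qed

text \<open>If \<open>u\<close> has no maximum on \<open>Q\<close>, it has none on any
  \<open>P i\<close>. Otherwise let \<open>F\<close> be the face it exposes: \<open>u\<close> has
  maximum \<open>m\<close> on \<open>P i\<close> iff a translate of the tangent cone at
  \<open>F\<close> by some \<open>v\<close> with \<open>u \<bullet> v = m\<close> tightly contains
  \<open>P i\<close>, and this translate is unique.\<close>

lemma sum_attains_max_eq_0_if_tight:
  fixes P :: "'i \<Rightarrow> 'a::euclidean_space set" and c :: "'i \<Rightarrow> int"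
  assumes "polyhedron Q" and fin: "finite I" and D: "\<And>i. i \<in> I \<Longrightarrow> P i \<in> DefPlus Q"
    and z: "\<And>T. T \<in> tran Q \<Longrightarrow> (\<Sum>i\<in>I. c i * of_bool (tightly_contains Q T (P i))) = 0"
  shows "(\<Sum>i\<in>I. c i * of_bool (attains_max (P i) u m)) = 0"
proof (cases "max_face Q u = {}")
  case True
  have "\<not> attains_max (P i) u m" if "i \<in> I" for i
  proof
    assume "attains_max (P i) u m"
    then obtain x where "x \<in> max_face (P i) u" by (auto simp: attains_max_def max_face_def)
    then show False using DefPlus_max_face(1)[OF assms(1) D[OF that]] True by blast
  qed
  then show ?thesis by simp
next
  case False
  define F where "F = max_face Q u"
  have F: "F face_of Q" "F \<noteq> {}"
    using False max_face_face_of polyhedron_imp_convex[OF assms(1)] by (auto simp: F_def)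
  have uF: "u \<in> normal_cone Q F" using max_face_self by (simp add: F_def)
  \<comment> \<open>Keeping only translates that are tight for some \<open>P i\<close> makes the sum
    over them finite.\<close>
  define TT where "TT = {T. (\<exists>i\<in>I. T \<in> tran Q \<and> tightly_contains Q T (P i)) \<and>
      (\<exists>v. T = (\<lambda>x. x + v) ` tangent_cone Q F \<and> u \<bullet> v = m)}"
  have "TT \<subseteq> (\<Union>i\<in>I. {T\<in>tran Q. tightly_contains Q T (P i)})" by (auto simp: TT_def)
  then have finT: "finite TT"
    by (rule finite_subset) (use fin finite_tightly_contains[OF assms(1)] in blast)
  have "(\<Sum>i\<in>I. c i * of_bool (attains_max (P i) u m))
      = (\<Sum>i\<in>I. \<Sum>T\<in>TT. c i * of_bool (tightly_contains Q T (P i)))"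
  proof (rule sum.cong[OF refl])
    fix i assume i: "i \<in> I"
    show "c i * of_bool (attains_max (P i) u m) = (\<Sum>T\<in>TT. c i * of_bool (tightly_contains Q T (P i)))"
    proof (cases "attains_max (P i) u m")
      case True
      then obtain x where x: "x \<in> P i" "x \<in> max_face (P i) u" "u \<bullet> x = m"
        by (auto simp: attains_max_def max_face_def)
      have nx: "normal_cone Q F \<subseteq> normal_cone (P i) {x}"
        unfolding F_def using DefPlus_max_face(2)[OF assms(1) D[OF i]] x by blast
      define T0 where "T0 = (\<lambda>y. y + x) ` tangent_cone Q F"
      have t0: "tightly_contains Q T0 (P i)"
        unfolding T0_def tightly_contains_iff[OF assms(1) F] using x nx by blast
      have T0: "T0 \<in> TT"
        unfolding TT_def using t0 i F x(3) by (auto simp: tran_iff T0_def)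
      have uni: "tightly_contains Q T (P i) \<longleftrightarrow> T = T0" if "T \<in> TT" for T
        using t0 tightly_contains_unique[OF assms(1) F _ x(1) nx] that unfolding TT_def T0_def by blast
      have "(\<Sum>T\<in>TT. c i * of_bool (tightly_contains Q T (P i))) = (\<Sum>T\<in>TT. if T = T0 then c i else 0)"
        by (rule sum.cong) (use uni in auto)
      then show ?thesis using T0 finT True by simp
    next
      case False
      have "\<not> tightly_contains Q T (P i)" if "T \<in> TT" for T
      proof
        assume t: "tightly_contains Q T (P i)"
        obtain v where v: "T = (\<lambda>x. x + v) ` tangent_cone Q F" "u \<bullet> v = m" using \<open>T \<in> TT\<close> by (auto simp: TT_def)
        then obtain x where "x \<in> P i" "normal_cone Q F \<subseteq> normal_cone (P i) {x}"
            "\<forall>w\<in>normal_cone Q F. w \<bullet> x = w \<bullet> v"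
          using t tightly_contains_iff[OF assms(1) F] by blast
        then have "attains_max (P i) u m"
          unfolding attains_max_def using uF v(2) mem_normal_cone_sing[of u "P i" x] by auto
        then show False using False by simp
      qed
      then show ?thesis using False by simp
    qed
  qed
  also have "\<dots> = (\<Sum>T\<in>TT. \<Sum>i\<in>I. c i * of_bool (tightly_contains Q T (P i)))" by (rule sum.swap)
  also have "\<dots> = 0" by (rule sum.neutral) (use z in \<open>auto simp: TT_def\<close>)
  finally show ?thesis .
qed

text \<open>Adding a positive multiple of an element of the normal cone to \<open>u\<close> leaves
  the exposed face unchanged, and all but finitely many multiples avoid zeros on the given
  vectors.\<close>

lemma generic_exposed_by:
  fixes Q :: "'a::euclidean_space set"
  assumes "polyhedron Q" "F face_of Q" "F \<noteq> {}" "finite D"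
    and "\<And>d. d \<in> D \<Longrightarrow> \<exists>w\<in>normal_cone Q F. w \<bullet> d \<noteq> 0"
  shows "\<exists>u. max_face Q u = F \<and> (\<forall>d\<in>D. u \<bullet> d \<noteq> 0)"
  using assms(4,5)
proof (induction D rule: finite_induct)
  case empty
  show ?case using exposed_by[OF assms(1-3)] by auto
next
  case (insert d D)
  then obtain u where u: "max_face Q u = F" "\<forall>d\<in>D. u \<bullet> d \<noteq> 0" by auto
  obtain w where w: "w \<in> normal_cone Q F" "w \<bullet> d \<noteq> 0" using insert.prems by blast
  \<comment> \<open>The multiples at which the perturbed functional vanishes on some vector. Where
    \<open>w\<close> vanishes, the nonzero value of \<open>u\<close> persists, and division by zero
    merely adds 0 to the set.\<close>
  define B where "B = (\<lambda>d. - (u \<bullet> d) / (w \<bullet> d)) ` insert d D"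
  have "finite B" using insert.hyps by (simp add: B_def)
  moreover have "infinite {0<..(1::real)}" by (simp add: infinite_Ioc)
  ultimately obtain e where e: "e > 0" "e \<notin> B"
    by (metis finite_subset greaterThanAtMost_iff subsetI)
  have FQ: "F \<subseteq> Q" by (rule face_of_imp_subset[OF assms(2)])
  have "max_face Q (u + e *\<^sub>R w) = F"
  proof
    have "(u + e *\<^sub>R w) \<bullet> y \<le> (u + e *\<^sub>R w) \<bullet> f" if "f \<in> F" "y \<in> Q" for f y
    proof -
      have "u \<bullet> y \<le> u \<bullet> f" "w \<bullet> y \<le> w \<bullet> f" using that u(1) w(1) by (auto simp: max_face_def normal_cone_def)
      then show ?thesis using e by (simp add: inner_add_left add_mono)
    qed
    then show "F \<subseteq> max_face Q (u + e *\<^sub>R w)" using FQ by (auto simp: max_face_def)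
    show "max_face Q (u + e *\<^sub>R w) \<subseteq> F"
    proof
      fix x assume x: "x \<in> max_face Q (u + e *\<^sub>R w)"
      obtain f where f: "f \<in> F" using assms(3) by blast
      have "(u + e *\<^sub>R w) \<bullet> f \<le> (u + e *\<^sub>R w) \<bullet> x" "x \<in> Q" using x f FQ by (auto simp: max_face_def)
      moreover have "w \<bullet> x \<le> w \<bullet> f" using w(1) f \<open>x \<in> Q\<close> by (auto simp: normal_cone_def)
      then have "e * (w \<bullet> x) \<le> e * (w \<bullet> f)" using e by simp
      ultimately have "u \<bullet> f \<le> u \<bullet> x" by (simp add: inner_add_left)
      moreover have "\<forall>y\<in>Q. u \<bullet> y \<le> u \<bullet> f" using f u(1) by (auto simp: max_face_def)
      ultimately have "\<forall>y\<in>Q. u \<bullet> y \<le> u \<bullet> x" using order_trans by blast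
      then show "x \<in> F" using \<open>x \<in> Q\<close> u(1) by (auto simp: max_face_def)
    qed
  qed
  moreover have "(u + e *\<^sub>R w) \<bullet> d' \<noteq> 0" if d': "d' \<in> insert d D" for d'
  proof
    assume *: "(u + e *\<^sub>R w) \<bullet> d' = 0"
    show False
    proof (cases "w \<bullet> d' = 0")
      case True
      then show False using * d' u(2) w(2) by (auto simp: inner_add_left)
    next
      case False
      then have "e = - (u \<bullet> d') / (w \<bullet> d')" using * by (simp add: inner_add_left field_simps)
      then show False using e d' by (auto simp: B_def)
    qed
  qed
  ultimately show ?case by blast
qed

text \<open>For a functional \<open>u\<close> exposing \<open>F\<close> and separating the finitely many cosets involved, tight
  containment in a translate of the tangent cone at \<open>F\<close> is read off from the maximum of \<open>u\<close> alone.\<close>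

lemma sum_tight_eq_0_if_attains_max:
  fixes P :: "'i \<Rightarrow> 'a::euclidean_space set" and c :: "'i \<Rightarrow> int"
  assumes "polyhedron Q" and fin: "finite I" and D: "\<And>i. i \<in> I \<Longrightarrow> P i \<in> DefPlus Q"
    and z: "\<And>u m. (\<Sum>i\<in>I. c i * of_bool (attains_max (P i) u m)) = 0"
    and T: "T \<in> tran Q"
  shows "(\<Sum>i\<in>I. c i * of_bool (tightly_contains Q T (P i))) = 0"
proof -
  obtain F v where F: "F face_of Q" "F \<noteq> {}" and Tv: "T = (\<lambda>x. x + v) ` tangent_cone Q F"
    using T by (auto simp: tran_iff)
  define z where "z i = (SOME x. x \<in> P i \<and> normal_cone Q F \<subseteq> normal_cone (P i) {x})" for i
  have z: "z i \<in> P i" "normal_cone Q F \<subseteq> normal_cone (P i) {z i}"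
    if "x \<in> P i" "normal_cone Q F \<subseteq> normal_cone (P i) {x}" for x i
    using someI[of "\<lambda>x. x \<in> P i \<and> normal_cone Q F \<subseteq> normal_cone (P i) {x}" x] that
    unfolding z_def by auto
  \<comment> \<open>Only offsets detected by some functional of the normal cone can be kept away
    from 0 by \<open>u\<close>; the others do not change the translate.\<close>
  define E where "E = {d \<in> (\<lambda>i. z i - v) ` I. \<exists>w\<in>normal_cone Q F. w \<bullet> d \<noteq> 0}"
  have "\<exists>u. max_face Q u = F \<and> (\<forall>d\<in>E. u \<bullet> d \<noteq> 0)"
    by (rule generic_exposed_by[OF assms(1) F]) (use fin in \<open>auto simp: E_def\<close>)
  then obtain u where u: "max_face Q u = F" "\<forall>d\<in>E. u \<bullet> d \<noteq> 0" by blast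
  have uF: "u \<in> normal_cone Q F" using max_face_self u(1) by blast
  have "tightly_contains Q T (P i) \<longleftrightarrow> attains_max (P i) u (u \<bullet> v)" if i: "i \<in> I" for i
  proof
    assume "tightly_contains Q T (P i)"
    then obtain x where "x \<in> P i" "normal_cone Q F \<subseteq> normal_cone (P i) {x}"
        "\<forall>w\<in>normal_cone Q F. w \<bullet> x = w \<bullet> v"
      unfolding Tv tightly_contains_iff[OF assms(1) F] by blast
    then show "attains_max (P i) u (u \<bullet> v)"
      unfolding attains_max_def using uF mem_normal_cone_sing[of u "P i" x] by auto
  next
    assume "attains_max (P i) u (u \<bullet> v)"
    then obtain x where x: "x \<in> P i" "x \<in> max_face (P i) u" "u \<bullet> x = u \<bullet> v"
      by (auto simp: attains_max_def max_face_def)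
    have nx: "normal_cone Q F \<subseteq> normal_cone (P i) {x}"
      using DefPlus_max_face(2)[OF assms(1) D[OF i] x(2)] u(1) by simp
    note zi = z[OF x(1) nx]
    have "u \<bullet> z i = u \<bullet> x"
      using zi nx uF x(1) unfolding subset_iff mem_normal_cone_sing by (metis order_antisym)
    then have "u \<bullet> (z i - v) = 0" using x(3) by (simp add: inner_diff_right)
    then have "z i - v \<notin> E" using u(2) by blast
    then have "\<forall>w\<in>normal_cone Q F. w \<bullet> z i = w \<bullet> v" using i by (auto simp: E_def inner_diff_right)
    then show "tightly_contains Q T (P i)"
      unfolding Tv tightly_contains_iff[OF assms(1) F] using zi by blast
  qed
  then show ?thesis using assms(4)[of u "u \<bullet> v"] by (simp cong: sum.cong)
qed

section \<open>Spans and the universal property\<close>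

text \<open>Each \<open>u\<close> in a normal cone \<open>N\<close> of \<open>T\<close> lies in the
  normal cone of the face of \<open>Q\<close> that it exposes, and that cone is contained in
  \<open>N\<close>. So \<open>N\<close> is the union of these cones.\<close>

lemma tran_in_DefPlus:
  fixes Q :: "'a::euclidean_space set"
  assumes Q: "polyhedron Q" and T: "T \<in> tran Q"
  shows "T \<in> DefPlus Q"
proof -
  obtain F v where F: "F face_of Q" "F \<noteq> {}" and Tv: "T = (\<lambda>x. x + v) ` tangent_cone Q F"
    using T by (auto simp: tran_iff)
  let ?C = "tangent_cone Q F"
  have cQ: "convex Q" by (rule polyhedron_imp_convex[OF Q])
  have FQ: "F \<subseteq> Q" by (rule face_of_imp_subset[OF F(1)])
  obtain x0 where x0: "x0 \<in> rel_interior F"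
    using F face_of_imp_convex rel_interior_eq_empty by blast
  then have x0F: "x0 \<in> F" using rel_interior_subset by blast
  have "\<exists>S\<subseteq>normal_fan Q. N = \<Union>S" if N: "N \<in> normal_fan T" for N
  proof -
    obtain G where G: "G face_of T" "G \<noteq> {}" "N = normal_cone T G" using N by (auto simp: normal_fan_def)
    have GT: "G \<subseteq> T" by (rule face_of_imp_subset[OF G(1)])
    have key: "F \<subseteq> max_face Q u \<and> normal_cone Q (max_face Q u) \<subseteq> N" if u: "u \<in> N" for u
    proof
      have uT: "u \<bullet> x \<le> u \<bullet> y" if "y \<in> G" "x \<in> T" for x y
        using u that unfolding G(3) normal_cone_def by blast
      have u0: "u \<bullet> x \<le> 0" if x: "x \<in> ?C" for x
      proof -
        obtain y where y: "y \<in> G" using G(2) by blast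
        then have "y - v \<in> ?C" using GT unfolding Tv by (auto simp: mem_translation_iff)
        then have "x + (y - v) \<in> ?C" using x convex_cone_tangent_cone convex_cone_add by blast
        then have "x + y \<in> T" unfolding Tv by (simp add: mem_translation_iff algebra_simps)
        from uT[OF y this] show ?thesis by (simp add: inner_add_right)
      qed
      have uG: "u \<bullet> (y - v) = 0" if y: "y \<in> G" for y
      proof (rule order_antisym)
        have "y - v \<in> ?C" using y GT unfolding Tv by (auto simp: mem_translation_iff)
        then show "u \<bullet> (y - v) \<le> 0" by (rule u0)
        have "v \<in> T" unfolding Tv mem_translation_iff using convex_cone_tangent_cone convex_cone_contains_0 by auto
        from uT[OF y this] show "0 \<le> u \<bullet> (y - v)" by (simp add: inner_diff_right)
      qed
      show FM: "F \<subseteq> max_face Q u"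
      proof
        fix f assume f: "f \<in> F"
        have "u \<bullet> (q - f) \<le> 0" if "q \<in> Q" for q
          by (rule u0, unfold tangent_cone_def, rule hull_inc) (use f that in blast)
        then show "f \<in> max_face Q u" using f FQ by (auto simp: max_face_def inner_diff_right)
      qed
      show "normal_cone Q (max_face Q u) \<subseteq> N"
      proof
        fix w assume w: "w \<in> normal_cone Q (max_face Q u)"
        then have wF: "w \<in> normal_cone Q F" using normal_cone_antimono[OF FM] by blast
        have wG: "w \<bullet> (y - v) = 0" if y: "y \<in> G" for y
        proof -
          have "y - v \<in> ?C" using y GT unfolding Tv by (auto simp: mem_translation_iff)
          then obtain l q where lq: "y - v = l *\<^sub>R (q - x0)" "q \<in> Q"
            unfolding tangent_cone_at_rel_interior[OF cQ F(1) x0] by blast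
          show ?thesis
          proof (cases "l = 0")
            case False
            \<comment> \<open>Since \<open>u\<close> does not distinguish \<open>q\<close> from
              \<open>x0\<close>, both lie in the face it exposes, on which \<open>w\<close> is
              constant.\<close>
            then have "u \<bullet> q = u \<bullet> x0" using uG[OF y] lq(1) by (simp add: inner_diff_right)
            then have "q \<in> max_face Q u" using x0F FM lq(2) by (auto simp: max_face_def)
            moreover have "x0 \<in> max_face Q u" using x0F FM by blast
            ultimately have "w \<bullet> q = w \<bullet> x0"
              using w max_face_subset[of Q u] unfolding normal_cone_def by (blast intro: order_antisym)
            then show ?thesis using lq(1) by (simp add: inner_diff_right)
          qed (use lq in simp)
        qed
        show "w \<in> N"
          unfolding G(3) normal_cone_def
        proof (intro CollectI ballI)
          fix y x assume y: "y \<in> G" and x: "x \<in> T"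
          have "x - v \<in> ?C" using x unfolding Tv mem_translation_iff .
          then have "w \<bullet> (x - v) \<le> 0" using tangent_cone_polar[OF wF] by blast
          then show "w \<bullet> x \<le> w \<bullet> y" using wG[OF y] by (simp add: inner_diff_right)
        qed
      qed
    qed
    define S where "S = (\<lambda>u. normal_cone Q (max_face Q u)) ` N"
    have "max_face Q u face_of Q" for u by (rule max_face_face_of[OF cQ])
    moreover have "max_face Q u \<noteq> {}" if "u \<in> N" for u using key[OF that] F(2) by blast
    ultimately have "S \<subseteq> normal_fan Q" by (auto simp: S_def normal_fan_def)
    moreover have "N = \<Union>S" using key max_face_self unfolding S_def by blast
    ultimately show ?thesis by blast
  qed
  then show ?thesis
    using polyhedron_tangent_cone_translate[OF Q F] unfolding DefPlus_def Tv by blast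
qed

section \<open>Integer spans of families of functions\<close>

text \<open>One notion for three groups: \<open>int_span\<close> is the case of
  \<open>indicator\<close>, \<open>free_ab\<close> that of \<open>basis_e\<close>, and
  \<open>Fimg Q\<close> gives the image of the map.\<close>

definition zspan :: "('p \<Rightarrow> 'c \<Rightarrow> int) \<Rightarrow> 'p set \<Rightarrow> ('c \<Rightarrow> int) set" where
  "zspan F X = {\<phi>. \<exists>S c. finite S \<and> S \<subseteq> X \<and> \<phi> = (\<lambda>t. \<Sum>P\<in>S. c P * F P t)}"

lemma zspanI: "finite S \<Longrightarrow> S \<subseteq> X \<Longrightarrow> (\<lambda>t. \<Sum>P\<in>S. c P * F P t) \<in> zspan F X"
  unfolding zspan_def by blast

lemma zspanE:
  assumes "\<phi> \<in> zspan F X"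
  obtains S c where "finite S" "S \<subseteq> X" "\<phi> = (\<lambda>t. \<Sum>P\<in>S. c P * F P t)"
  using assms unfolding zspan_def by blast

lemma zspan_base: "P \<in> X \<Longrightarrow> F P \<in> zspan F X"
  using zspanI[of "{P}" X "\<lambda>_. 1" F] by simp

lemma zspan_zero: "(\<lambda>t. 0) \<in> zspan F X"
  using zspanI[of "{}" X _ F] by simp

lemma zspan_scale: "\<phi> \<in> zspan F X \<Longrightarrow> (\<lambda>t. k * \<phi> t) \<in> zspan F X"
proof -
  assume "\<phi> \<in> zspan F X"
  then obtain S c where S: "finite S" "S \<subseteq> X" "\<phi> = (\<lambda>t. \<Sum>P\<in>S. c P * F P t)" by (rule zspanE)
  have "(\<lambda>t. \<Sum>P\<in>S. (k * c P) * F P t) \<in> zspan F X" by (rule zspanI[OF S(1,2)])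
  then show ?thesis by (simp add: S(3) sum_distrib_left mult.assoc)
qed

text \<open>Padding with zero coefficients brings both combinations to one index set, where
  coefficients can be added or subtracted.\<close>

lemma zspan_common:
  assumes "\<phi> \<in> zspan F X" "\<psi> \<in> zspan F X"
  obtains S c d where "finite S" "S \<subseteq> X" "\<phi> = (\<lambda>t. \<Sum>P\<in>S. c P * F P t)" "\<psi> = (\<lambda>t. \<Sum>P\<in>S. d P * F P t)"
proof -
  obtain S c where S: "finite S" "S \<subseteq> X" "\<phi> = (\<lambda>t. \<Sum>P\<in>S. c P * F P t)" using assms(1) by (rule zspanE)
  obtain S' c' where S': "finite S'" "S' \<subseteq> X" "\<psi> = (\<lambda>t. \<Sum>P\<in>S'. c' P * F P t)" using assms(2) by (rule zspanE)
  have "\<phi> = (\<lambda>t. \<Sum>P\<in>S \<union> S'. (if P \<in> S then c P else 0) * F P t)"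
    unfolding S(3) by (rule ext, rule sum.mono_neutral_cong_left) (use S S' in auto)
  moreover have "\<psi> = (\<lambda>t. \<Sum>P\<in>S \<union> S'. (if P \<in> S' then c' P else 0) * F P t)"
    unfolding S'(3) by (rule ext, rule sum.mono_neutral_cong_left) (use S S' in auto)
  ultimately show thesis by (rule that[rotated 2]) (use S S' in auto)
qed

lemma zspan_add:
  assumes "\<phi> \<in> zspan F X" "\<psi> \<in> zspan F X"
  shows "(\<lambda>t. \<phi> t + \<psi> t) \<in> zspan F X"
proof -
  obtain S c d where S: "finite S" "S \<subseteq> X" "\<phi> = (\<lambda>t. \<Sum>P\<in>S. c P * F P t)" "\<psi> = (\<lambda>t. \<Sum>P\<in>S. d P * F P t)"
    using zspan_common[OF assms] .
  have "(\<lambda>t. \<Sum>P\<in>S. (c P + d P) * F P t) \<in> zspan F X" by (rule zspanI[OF S(1,2)])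
  then show ?thesis by (simp add: S(3,4) distrib_right sum.distrib)
qed

lemma zspan_diff:
  assumes "\<phi> \<in> zspan F X" "\<psi> \<in> zspan F X"
  shows "(\<lambda>t. \<phi> t - \<psi> t) \<in> zspan F X"
  using zspan_add[OF assms(1) zspan_scale[OF assms(2), of "-1"]] by simp

lemma zspan_sum:
  assumes "\<And>s. s \<in> S \<Longrightarrow> \<phi> s \<in> zspan F X"
  shows "(\<lambda>t. \<Sum>s\<in>S. \<phi> s t) \<in> zspan F X"
  using assms
proof (induction S rule: infinite_finite_induct)
  case (insert s S)
  then have "(\<lambda>t. \<phi> s t + (\<Sum>s\<in>S. \<phi> s t)) \<in> zspan F X" by (intro zspan_add) auto
  then show ?case using insert by simp
qed (auto intro: zspan_zero)

lemma zspan_subset: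
  assumes "\<And>P. P \<in> X \<Longrightarrow> F P \<in> zspan G Y"
  shows "zspan F X \<subseteq> zspan G Y"
proof
  fix \<phi> assume "\<phi> \<in> zspan F X"
  then obtain S c where S: "finite S" "S \<subseteq> X" "\<phi> = (\<lambda>t. \<Sum>P\<in>S. c P * F P t)" by (rule zspanE)
  show "\<phi> \<in> zspan G Y" unfolding S(3) using S(2) assms by (intro zspan_sum zspan_scale) auto
qed

lemma free_ab_eq_zspan: "free_ab S = zspan basis_e S"
proof
  show "free_ab S \<subseteq> zspan basis_e S"
  proof
    fix \<phi> assume "\<phi> \<in> free_ab S"
    then have fin: "finite {s. \<phi> s \<noteq> 0}" and sub: "{s. \<phi> s \<noteq> 0} \<subseteq> S" by (auto simp: free_ab_def)
    have "\<phi> = (\<lambda>t. \<Sum>s\<in>{s. \<phi> s \<noteq> 0}. \<phi> s * basis_e s t)"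
    proof
      fix t
      have "(\<Sum>s\<in>{s. \<phi> s \<noteq> 0}. \<phi> s * basis_e s t) = (\<Sum>s\<in>{s. \<phi> s \<noteq> 0}. if s = t then \<phi> t else 0)"
        by (rule sum.cong) (auto simp: basis_e_def)
      then show "\<phi> t = (\<Sum>s\<in>{s. \<phi> s \<noteq> 0}. \<phi> s * basis_e s t)" using fin by simp
    qed
    then show "\<phi> \<in> zspan basis_e S" using zspanI[OF fin sub] by metis
  qed
  show "zspan basis_e S \<subseteq> free_ab S"
  proof
    fix \<phi> :: "'a \<Rightarrow> int" assume "\<phi> \<in> zspan basis_e S"
    then obtain S' c where S': "finite S'" "S' \<subseteq> S" "\<phi> = (\<lambda>t. \<Sum>s\<in>S'. c s * basis_e s t)" by (rule zspanE)
    have "\<phi> t = 0" if "t \<notin> S'" for t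
      unfolding S'(3) by (rule sum.neutral) (use that in \<open>auto simp: basis_e_def\<close>)
    then have "{s. \<phi> s \<noteq> 0} \<subseteq> S'" by blast
    then show "\<phi> \<in> free_ab S" unfolding free_ab_def using S'(1,2) finite_subset by blast
  qed
qed

section \<open>Integer multiples and the universal property of spans\<close>

lemma zsmult_0 [simp]: "zsmult 0 a = 0"
  by (simp add: zsmult_def)

lemma zsmult_Suc: "zsmult (k + 1) a = zsmult k a + a"
proof (cases "k \<ge> 0")
  case True
  then have "nat (k + 1) = Suc (nat k)" by simp
  then show ?thesis using True by (simp add: zsmult_def)
next
  case False
  define n where "n = nat (- k - 1)"
  have "nat (- k) = Suc n" "nat (- (k + 1)) = n" using False by (auto simp: n_def)
  moreover have "zsmult (k + 1) a = - (\<Sum>i<nat (- (k + 1)). a)"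
    using False by (cases "k + 1 = 0") (auto simp: zsmult_def)
  ultimately show ?thesis using False by (simp add: zsmult_def)
qed

lemma zsmult_1 [simp]: "zsmult 1 a = a"
  using zsmult_Suc[of 0 a] by simp

lemma additive_eq_zsmult:
  fixes h :: "int \<Rightarrow> 'b::ab_group_add"
  assumes "\<And>k l. h (k + l) = h k + h l"
  shows "h k = zsmult k (h 1)"
proof (induction k rule: int_induct[of _ 0])
  case base
  have "h 0 + h 0 = h 0" using assms[of 0 0] by simp
  then show ?case by simp
next
  case (step1 i)
  then show ?case using assms zsmult_Suc by metis
next
  case (step2 i)
  have "h i = h (i - 1) + h 1" using assms[of "i - 1" 1] by simp
  moreover have "zsmult i (h 1) = zsmult (i - 1) (h 1) + h 1" using zsmult_Suc[of "i - 1"] by simp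
  ultimately show ?case using step2 by (metis add_right_cancel)
qed

lemma zsmult_add: "zsmult (k + l) a = zsmult k a + zsmult l a"
proof (induction l rule: int_induct[of _ 0])
  case (step1 i)
  have "zsmult (k + (i + 1)) a = zsmult (k + i) a + a" using zsmult_Suc[of "k + i"] by (simp add: add.assoc)
  then show ?case using step1 by (simp add: zsmult_Suc add.assoc)
next
  case (step2 i)
  have "zsmult (k + i) a = zsmult (k + (i - 1)) a + a" using zsmult_Suc[of "k + (i - 1)"] by (simp add: add.assoc)
  moreover have "zsmult i a = zsmult (i - 1) a + a" using zsmult_Suc[of "i - 1"] by simp
  ultimately show ?case using step2 by (metis add.assoc add_right_cancel)
qed simp

text \<open>Integer-valued functions form an abelian group pointwise, so results for a general
  target group also produce maps into \<open>free_ab\<close>.\<close>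

lemma zsmult_fun: "zsmult k (\<phi> :: 'c \<Rightarrow> int) = (\<lambda>t. k * \<phi> t)"
  using additive_eq_zsmult[of "\<lambda>k t. k * \<phi> t" k] by (simp add: plus_fun_def distrib_right)

lemma sum_fun_eq: "(\<Sum>P\<in>S. f P) = (\<lambda>t. \<Sum>P\<in>S. f P t :: 'b::comm_monoid_add)"
  by (induction S rule: infinite_finite_induct) (auto simp: zero_fun_def plus_fun_def)

text \<open>Additivity alone suffices: the map from \<open>k\<close> to the image of
  \<open>k\<close> times a generator is additive on the integers, hence given by multiples of its
  value at 1.\<close>

lemma zlinear_on_zspan:
  assumes g: "zlinear_on (zspan F X) g" and S: "finite S" "S \<subseteq> X"
  shows "g (\<lambda>t. \<Sum>P\<in>S. c P * F P t) = (\<Sum>P\<in>S. zsmult (c P) (g (F P)))"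
  using S
proof (induction S rule: finite_induct)
  case empty
  have "g (\<lambda>t. 0) + g (\<lambda>t. 0) = g (\<lambda>t. 0)"
    using g zspan_zero[of F X] unfolding zlinear_on_def by force
  then show ?case by simp
next
  case (insert P S)
  have sc: "(\<lambda>t. k * F P t) \<in> zspan F X" for k
    using insert.prems by (intro zspan_scale zspan_base) auto
  have "g (\<lambda>t. (k + l) * F P t) = g (\<lambda>t. k * F P t) + g (\<lambda>t. l * F P t)" for k l
    using g sc[of k] sc[of l] unfolding zlinear_on_def by (simp add: distrib_right)
  from additive_eq_zsmult[of "\<lambda>k. g (\<lambda>t. k * F P t)", OF this]
  have "g (\<lambda>t. c P * F P t) = zsmult (c P) (g (F P))" by simp
  moreover have "(\<lambda>t. \<Sum>P\<in>S. c P * F P t) \<in> zspan F X" using insert by (intro zspanI) auto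
  ultimately show ?case
    using g sc[of "c P"] insert unfolding zlinear_on_def by simp
qed

lemma zlinear_on_zspan_unique:
  assumes "zlinear_on (zspan F X) g" "zlinear_on (zspan F X) h"
    and "\<And>P. P \<in> X \<Longrightarrow> g (F P) = h (F P)" and "\<phi> \<in> zspan F X"
  shows "g \<phi> = h \<phi>"
proof -
  obtain S c where S: "finite S" "S \<subseteq> X" "\<phi> = (\<lambda>t. \<Sum>P\<in>S. c P * F P t)" using assms(4) by (rule zspanE)
  show ?thesis
    unfolding S(3) zlinear_on_zspan[OF assms(1) S(1,2)] zlinear_on_zspan[OF assms(2) S(1,2)]
    by (rule sum.cong) (use assms(3) S(2) in auto)
qed

text \<open>Two expressions of one element differ by a relation, which \<open>f\<close> respects, so
  the value computed from an expression depends on the element only. This yields both the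
  isomorphism and the factorisation of valuative functions.\<close>

lemma zspan_factor:
  fixes f :: "'p \<Rightarrow> 'b::ab_group_add"
  assumes ker: "\<And>S c. finite S \<Longrightarrow> S \<subseteq> X \<Longrightarrow> (\<And>t. (\<Sum>P\<in>S. c P * F P t) = 0)
      \<Longrightarrow> (\<Sum>P\<in>S. zsmult (c P) (f P)) = 0"
  shows "\<exists>g. zlinear_on (zspan F X) g \<and> (\<forall>P\<in>X. g (F P) = f P)"
proof -
  define R where "R \<phi> a \<longleftrightarrow> (\<exists>S c. finite S \<and> S \<subseteq> X \<and> \<phi> = (\<lambda>t. \<Sum>P\<in>S. c P * F P t)
      \<and> a = (\<Sum>P\<in>S. zsmult (c P) (f P)))" for \<phi> a
  have ex: "\<exists>a. R \<phi> a" if "\<phi> \<in> zspan F X" for \<phi> using that unfolding zspan_def R_def by blast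
  have zsd: "zsmult (k - l) x = zsmult k x - zsmult l x" for k l and x :: 'b
    using zsmult_add[of "k - l" l x] by simp
  have Rcommon: "\<exists>S c d. finite S \<and> S \<subseteq> X \<and> \<phi> = (\<lambda>t. \<Sum>P\<in>S. c P * F P t) \<and> a = (\<Sum>P\<in>S. zsmult (c P) (f P))
      \<and> \<psi> = (\<lambda>t. \<Sum>P\<in>S. d P * F P t) \<and> b = (\<Sum>P\<in>S. zsmult (d P) (f P))"
    if R: "R \<phi> a" "R \<psi> b" for \<phi> \<psi> a b
  proof -
    obtain S c where S: "finite S" "S \<subseteq> X" "\<phi> = (\<lambda>t. \<Sum>P\<in>S. c P * F P t)" "a = (\<Sum>P\<in>S. zsmult (c P) (f P))"
      using R(1) unfolding R_def by (elim exE conjE)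
    obtain S' c' where S': "finite S'" "S' \<subseteq> X" "\<psi> = (\<lambda>t. \<Sum>P\<in>S'. c' P * F P t)" "b = (\<Sum>P\<in>S'. zsmult (c' P) (f P))"
      using R(2) unfolding R_def by (elim exE conjE)
    have fin: "finite (S \<union> S')" using S(1) S'(1) by simp
    show ?thesis
    proof (rule exI[of _ "S \<union> S'"], rule exI[of _ "\<lambda>P. if P \<in> S then c P else 0"],
        rule exI[of _ "\<lambda>P. if P \<in> S' then c' P else 0"], intro conjI)
      show "\<phi> = (\<lambda>t. \<Sum>P\<in>S \<union> S'. (if P \<in> S then c P else 0) * F P t)"
        unfolding S(3) by (rule ext, rule sum.mono_neutral_cong_left[OF fin]) auto
      show "a = (\<Sum>P\<in>S \<union> S'. zsmult (if P \<in> S then c P else 0) (f P))"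
        unfolding S(4) by (rule sum.mono_neutral_cong_left[OF fin]) auto
      show "\<psi> = (\<lambda>t. \<Sum>P\<in>S \<union> S'. (if P \<in> S' then c' P else 0) * F P t)"
        unfolding S'(3) by (rule ext, rule sum.mono_neutral_cong_left[OF fin]) auto
      show "b = (\<Sum>P\<in>S \<union> S'. zsmult (if P \<in> S' then c' P else 0) (f P))"
        unfolding S'(4) by (rule sum.mono_neutral_cong_left[OF fin]) auto
    qed (use S(2) S'(2) fin in auto)
  qed
  have uniq: "a = b" if R: "R \<phi> a" "R \<phi> b" for \<phi> a b
  proof -
    obtain S c d where S: "finite S" "S \<subseteq> X" "\<phi> = (\<lambda>t. \<Sum>P\<in>S. c P * F P t)" "a = (\<Sum>P\<in>S. zsmult (c P) (f P))"
        "\<phi> = (\<lambda>t. \<Sum>P\<in>S. d P * F P t)" "b = (\<Sum>P\<in>S. zsmult (d P) (f P))"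
      using Rcommon[OF R] by (elim exE conjE)
    have "(\<Sum>P\<in>S. (c P - d P) * F P t) = 0" for t
      using fun_cong[OF trans[OF S(3)[symmetric] S(5)], of t] by (simp add: left_diff_distrib sum_subtractf)
    then have "(\<Sum>P\<in>S. zsmult (c P - d P) (f P)) = 0" by (rule ker[OF S(1,2)])
    then show ?thesis by (simp add: zsd sum_subtractf S(4,6))
  qed
  define g where "g \<phi> = (SOME a. R \<phi> a)" for \<phi>
  have gR: "R \<phi> (g \<phi>)" if "\<phi> \<in> zspan F X" for \<phi> unfolding g_def using ex[OF that] by (rule someI_ex)
  have geq: "g \<phi> = a" if "R \<phi> a" for \<phi> a
    unfolding g_def using that uniq by (intro some_equality) auto
  have "zlinear_on (zspan F X) g"
    unfolding zlinear_on_def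
  proof (intro ballI geq)
    fix \<phi> \<psi> assume "\<phi> \<in> zspan F X" "\<psi> \<in> zspan F X"
    from Rcommon[OF this[THEN gR]]
    obtain S c d where S: "finite S" "S \<subseteq> X" "\<phi> = (\<lambda>t. \<Sum>P\<in>S. c P * F P t)" "g \<phi> = (\<Sum>P\<in>S. zsmult (c P) (f P))"
        "\<psi> = (\<lambda>t. \<Sum>P\<in>S. d P * F P t)" "g \<psi> = (\<Sum>P\<in>S. zsmult (d P) (f P))"
      by (elim exE conjE)
    show "R (\<lambda>t. \<phi> t + \<psi> t) (g \<phi> + g \<psi>)"
      unfolding R_def
      by (rule exI[of _ S], rule exI[of _ "\<lambda>P. c P + d P"])
        (use S in \<open>simp add: distrib_right sum.distrib zsmult_add\<close>)
  qed
  moreover have "g (F P) = f P" if "P \<in> X" for P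
    by (rule geq, unfold R_def, rule exI[of _ "{P}"], rule exI[of _ "\<lambda>_. 1"]) (use that in simp)
  ultimately show ?thesis by blast
qed

text \<open>\<open>Fimg\<close> is unitriangular on translated tangent cones: apart from \<open>T\<close> itself, a translate
  tightly containing \<open>T\<close> comes from a strictly larger cone.\<close>

lemma basis_e_in_zspan_Fimg:
  fixes Q :: "'a::euclidean_space set"
  assumes Q: "polyhedron Q" and T: "T \<in> tran Q"
  shows "basis_e T \<in> zspan (Fimg Q) (DefPlus Q)"
proof -
  have finC: "finite (tangent_cones Q)"
  proof -
    have "tangent_cones Q \<subseteq> tangent_cone Q ` {F. F face_of Q}" by (auto simp: tangent_cones_def)
    then show ?thesis using finite_polyhedron_faces[OF Q] finite_subset by blast
  qed
  have "basis_e ((\<lambda>x. x + v) ` C) \<in> zspan (Fimg Q) (DefPlus Q)" if "C \<in> tangent_cones Q" for C v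
    using that
  \<comment> \<open>The measure counts the tangent cones strictly containing \<open>C\<close>; when
    there are none, \<open>Fimg Q T\<close> is \<open>basis_e T\<close> itself. The base point
    \<open>v\<close> varies, since larger cones occur with other translations.\<close>
  proof (induction "card {C'\<in>tangent_cones Q. C \<subset> C'}" arbitrary: C v rule: less_induct)
    case less
    define T where "T = (\<lambda>x. x + v) ` C"
    have cC: "convex_cone C" using less.prems convex_cone_tangent_cone by (auto simp: tangent_cones_def)
    have TT: "T \<in> tran Q" using less.prems by (auto simp: T_def tran_def)
    let ?S = "{T'\<in>tran Q. tightly_contains Q T' T}"
    have fin: "finite ?S" by (rule finite_tightly_contains[OF Q])
    have "v \<in> T" unfolding T_def mem_translation_iff using convex_cone_contains_0[OF cC] by simp
    moreover have "v \<in> (\<lambda>x. x + v) ` lineal C"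
      unfolding mem_translation_iff lineal_def using convex_cone_contains_0[OF cC] by force
    ultimately have self: "tightly_contains Q T T"
      unfolding tightly_contains_def using less.prems T_def by blast
    have "basis_e T' \<in> zspan (Fimg Q) (DefPlus Q)" if T': "T' \<in> ?S - {T}" for T'
    proof -
      obtain C' v' where C': "C' \<in> tangent_cones Q" "T' = (\<lambda>x. x + v') ` C'" "T \<subseteq> T'"
          "T \<inter> (\<lambda>x. x + v') ` lineal C' \<noteq> {}"
        using T' unfolding tightly_contains_def by blast
      have cC': "convex_cone C'" using C'(1) convex_cone_tangent_cone by (auto simp: tangent_cones_def)
      obtain x where "x \<in> T" "x \<in> (\<lambda>x. x + v') ` lineal C'" using C'(4) by blast
      then have x: "x - v \<in> C" "x - v' \<in> lineal C'"
        unfolding T_def mem_translation_iff by blast+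
      have "v' - x \<in> C'"
      proof -
        have "x - v' \<in> uminus ` C'" using x(2) by (simp add: lineal_def)
        then show ?thesis by (metis image_iff minus_diff_eq minus_minus)
      qed
      \<comment> \<open>Since \<open>x\<close> lies in the lineality part of \<open>T'\<close>, the
        vector \<open>v' - x\<close> belongs to \<open>C'\<close> and carries
        \<open>c + x - v'\<close> back to \<open>c\<close>.\<close>
      have sub: "C \<subseteq> C'"
      proof
        fix c assume c: "c \<in> C"
        have "c + (x - v) \<in> C" using c x(1) cC convex_cone_add by blast
        then have "c + x \<in> T'" using C'(3) unfolding T_def unfolding subset_iff mem_translation_iff by (simp add: algebra_simps)
        then have "c + x - v' \<in> C'" unfolding C'(2) mem_translation_iff .
        then have "(c + x - v') + (v' - x) \<in> C'" using \<open>v' - x \<in> C'\<close> cC' convex_cone_add by blast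
        then show "c \<in> C'" by simp
      qed
      \<comment> \<open>With equal cones, passing from \<open>v'\<close> to \<open>v\<close> through
        \<open>x\<close> stays in the cone, which would force \<open>T' = T\<close>.\<close>
      have "C \<noteq> C'"
      proof
        assume eq: "C = C'"
        have "T' \<subseteq> T"
        proof
          fix y assume "y \<in> T'"
          then have "y - v' \<in> C" unfolding C'(2) mem_translation_iff eq .
          then have "(y - v') + ((v' - x) + (x - v)) \<in> C"
            using x(1) \<open>v' - x \<in> C'\<close> cC convex_cone_add unfolding eq by blast
          then show "y \<in> T" unfolding T_def mem_translation_iff by simp
        qed
        then show False using T' C'(3) by blast
      qed
      with sub have lt: "C \<subset> C'" by blast
      have "{D\<in>tangent_cones Q. C' \<subset> D} \<subset> {D\<in>tangent_cones Q. C \<subset> D}" using lt C'(1) by blast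
      then have "card {D\<in>tangent_cones Q. C' \<subset> D} < card {D\<in>tangent_cones Q. C \<subset> D}"
        using finC by (intro psubset_card_mono) auto
      then show ?thesis unfolding C'(2) using less.hyps C'(1) by blast
    qed
    then have "(\<lambda>t. \<Sum>T'\<in>?S - {T}. basis_e T' t) \<in> zspan (Fimg Q) (DefPlus Q)" by (rule zspan_sum)
    moreover have "Fimg Q T \<in> zspan (Fimg Q) (DefPlus Q)" by (rule zspan_base[OF tran_in_DefPlus[OF Q TT]])
    ultimately have "(\<lambda>t. Fimg Q T t - (\<Sum>T'\<in>?S - {T}. basis_e T' t)) \<in> zspan (Fimg Q) (DefPlus Q)"
      using zspan_diff by blast
    moreover have "Fimg Q T t - (\<Sum>T'\<in>?S - {T}. basis_e T' t) = basis_e T t" for t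
      unfolding Fimg_def using sum.remove[OF fin, of T "\<lambda>T'. basis_e T' t"] self TT by simp
    ultimately show ?case unfolding T_def by simp
  qed
  then show ?thesis using T unfolding tran_def by blast
qed

lemma zspan_Fimg:
  fixes Q :: "'a::euclidean_space set"
  assumes Q: "polyhedron Q"
  shows "zspan (Fimg Q) (DefPlus Q) = free_ab (tran Q)"
proof
  show "free_ab (tran Q) \<subseteq> zspan (Fimg Q) (DefPlus Q)"
    unfolding free_ab_eq_zspan by (rule zspan_subset) (rule basis_e_in_zspan_Fimg[OF Q])
  have "Fimg Q P \<in> zspan basis_e (tran Q)" for P
    unfolding Fimg_def by (rule zspan_sum) (auto intro: zspan_base)
  then show "zspan (Fimg Q) (DefPlus Q) \<subseteq> free_ab (tran Q)"
    unfolding free_ab_eq_zspan by (rule zspan_subset)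
qed

section \<open>Comparison of the relations and the isomorphism\<close>

text \<open>Both sides are equivalent to the relation among \<open>attains_max\<close>. Left to
  right gives well-definedness on the span of indicators; right to left gives injectivity and the
  factorisation of valuative functions.\<close>

lemma indicator_relation_iff_Fimg_relation:
  fixes Q :: "'a::euclidean_space set"
  assumes Q: "polyhedron Q" and S: "finite S" "S \<subseteq> DefPlus Q"
  shows "(\<forall>x. (\<Sum>P\<in>S. c P * indicator P x) = (0::int)) \<longleftrightarrow> (\<forall>T. (\<Sum>P\<in>S. c P * Fimg Q P T) = 0)"
proof -
  have D: "P \<in> DefPlus Q" if "P \<in> S" for P using S(2) that by blast
  have ph: "polyhedron P" if "P \<in> S" for P using D[OF that] by (rule DefPlus_polyhedron)
  have ind: "indicator P x = (of_bool (x \<in> P) :: int)" for P and x :: 'a by (simp add: indicator_def)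
  have "(\<forall>x. (\<Sum>P\<in>S. c P * of_bool (x \<in> P)) = 0) \<longleftrightarrow>
      (\<forall>u m. (\<Sum>P\<in>S. c P * of_bool (attains_max P u m)) = 0)"
    using sum_attains_max_eq_0[where P = "\<lambda>P. P", OF S(1) ph] sum_of_bool_mem_eq_0[where P = "\<lambda>P. P", OF S(1) ph]
    by metis
  also have "\<dots> \<longleftrightarrow> (\<forall>T\<in>tran Q. (\<Sum>P\<in>S. c P * of_bool (tightly_contains Q T P)) = 0)"
    using sum_attains_max_eq_0_if_tight[where P = "\<lambda>P. P", OF Q S(1) D]
      sum_tight_eq_0_if_attains_max[where P = "\<lambda>P. P", OF Q S(1) D] by metis
  also have "\<dots> \<longleftrightarrow> (\<forall>T. (\<Sum>P\<in>S. c P * Fimg Q P T) = 0)"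
  proof -
    have F: "Fimg Q P T = of_bool (T \<in> tran Q \<and> tightly_contains Q T P)" for P T
      by (rule Fimg_apply[OF finite_tightly_contains[OF Q]])
    have "(\<Sum>P\<in>S. c P * Fimg Q P T) =
        (if T \<in> tran Q then \<Sum>P\<in>S. c P * of_bool (tightly_contains Q T P) else 0)" for T
      unfolding F by simp
    then show ?thesis by (simp add: Ball_def)
  qed
  finally show ?thesis unfolding ind .
qed

theorem theorem2p7:
  fixes Q :: "'a::euclidean_space set"
  assumes "polyhedron Q"
  shows "(\<forall>P\<in>DefPlus Q. finite {T\<in>tran Q. tightly_contains Q T P})
    \<and> (\<exists>\<Phi> :: ('a \<Rightarrow> int) \<Rightarrow> ('a set \<Rightarrow> int).
          zlinear_fun_on (int_span (DefPlus Q)) \<Phi>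
        \<and> (\<forall>P\<in>DefPlus Q. \<Phi> (indicator P) = Fimg Q P)
        \<and> bij_betw \<Phi> (int_span (DefPlus Q)) (free_ab (tran Q)))
    \<and> (\<forall>\<Phi> \<Psi> :: ('a \<Rightarrow> int) \<Rightarrow> ('a set \<Rightarrow> int).
          zlinear_fun_on (int_span (DefPlus Q)) \<Phi> \<and> (\<forall>P\<in>DefPlus Q. \<Phi> (indicator P) = Fimg Q P)
        \<and> zlinear_fun_on (int_span (DefPlus Q)) \<Psi> \<and> (\<forall>P\<in>DefPlus Q. \<Psi> (indicator P) = Fimg Q P)
        \<longrightarrow> (\<forall>x\<in>int_span (DefPlus Q). \<Phi> x = \<Psi> x))
    \<and> (\<forall>f :: 'a set \<Rightarrow> 'b::ab_group_add. valuative (DefPlus Q) f \<longrightarrow>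
          (\<exists>g. zlinear_on (free_ab (tran Q)) g \<and> (\<forall>P\<in>DefPlus Q. f P = g (Fimg Q P)))
        \<and> (\<forall>g1 g2. zlinear_on (free_ab (tran Q)) g1 \<and> (\<forall>P\<in>DefPlus Q. f P = g1 (Fimg Q P))
              \<and> zlinear_on (free_ab (tran Q)) g2 \<and> (\<forall>P\<in>DefPlus Q. f P = g2 (Fimg Q P))
              \<longrightarrow> (\<forall>x\<in>free_ab (tran Q). g1 x = g2 x)))"
proof (intro conjI)
  let ?X = "DefPlus Q"
  have span: "int_span ?X = zspan indicator ?X" by (simp add: int_span_def zspan_def)
  have lin: "zlinear_fun_on A \<Phi> \<longleftrightarrow> zlinear_on A \<Phi>" for A and \<Phi> :: "('a \<Rightarrow> int) \<Rightarrow> ('a set \<Rightarrow> int)"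
    by (simp add: zlinear_fun_on_def zlinear_on_def plus_fun_def)
  note rel = indicator_relation_iff_Fimg_relation[OF assms]
  have zsum: "(\<Sum>P\<in>S. zsmult (c P) (Fimg Q P)) = (\<lambda>T. \<Sum>P\<in>S. c P * Fimg Q P T)" for S c
    by (simp add: zsmult_fun sum_fun_eq)

  show "\<forall>P\<in>?X. finite {T\<in>tran Q. tightly_contains Q T P}"
    using finite_tightly_contains[OF assms] by blast

  have "\<exists>\<Phi>. zlinear_on (zspan indicator ?X) \<Phi> \<and> (\<forall>P\<in>?X. \<Phi> (indicator P) = Fimg Q P)"
  proof (rule zspan_factor)
    fix S and c :: "'a set \<Rightarrow> int"
    assume S: "finite S" "S \<subseteq> ?X" and z: "\<And>t. (\<Sum>P\<in>S. c P * indicator P t) = 0"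
    have "\<forall>T. (\<Sum>P\<in>S. c P * Fimg Q P T) = 0" using rel[OF S, of c] z by blast
    then show "(\<Sum>P\<in>S. zsmult (c P) (Fimg Q P)) = 0" unfolding zsum by (simp add: zero_fun_def)
  qed
  then obtain \<Phi> where \<Phi>: "zlinear_on (zspan indicator ?X) \<Phi>" "\<And>P. P \<in> ?X \<Longrightarrow> \<Phi> (indicator P) = Fimg Q P"
    by blast
  have val: "\<Phi> (\<lambda>t. \<Sum>P\<in>S. c P * indicator P t) = (\<lambda>T. \<Sum>P\<in>S. c P * Fimg Q P T)"
    if S: "finite S" "S \<subseteq> ?X" for S c
  proof -
    have "(\<Sum>P\<in>S. zsmult (c P) (\<Phi> (indicator P))) = (\<Sum>P\<in>S. zsmult (c P) (Fimg Q P))"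
      by (rule sum.cong) (use \<Phi>(2) S(2) in auto)
    then show ?thesis unfolding zlinear_on_zspan[OF \<Phi>(1) S] zsum .
  qed
  \<comment> \<open>If the images agree, the differences of coefficients form a relation among the
    \<open>Fimg Q P\<close>, hence among the indicators.\<close>
  have "inj_on \<Phi> (zspan indicator ?X)"
  proof (rule inj_onI)
    fix \<phi> \<psi> assume mem: "\<phi> \<in> zspan indicator ?X" "\<psi> \<in> zspan indicator ?X" and eq: "\<Phi> \<phi> = \<Phi> \<psi>"
    obtain S c d where S: "finite S" "S \<subseteq> ?X" "\<phi> = (\<lambda>t. \<Sum>P\<in>S. c P * indicator P t)"
        "\<psi> = (\<lambda>t. \<Sum>P\<in>S. d P * indicator P t)"
      using zspan_common[OF mem] .
    have "(\<Sum>P\<in>S. (c P - d P) * Fimg Q P T) = 0" for T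
      using fun_cong[OF eq, of T] unfolding S(3,4) val[OF S(1,2)] by (simp add: left_diff_distrib sum_subtractf)
    then have "\<forall>x. (\<Sum>P\<in>S. (c P - d P) * indicator P x) = (0::int)" using iffD2[OF rel[OF S(1,2), of "\<lambda>P. c P - d P"]] by blast
    then show "\<phi> = \<psi>" unfolding S(3,4) by (simp add: left_diff_distrib sum_subtractf)
  qed
  moreover have "\<Phi> ` zspan indicator ?X = free_ab (tran Q)"
  proof -
    have "\<Phi> ` zspan indicator ?X = zspan (Fimg Q) ?X"
    proof (intro equalityI subsetI)
      fix y assume "y \<in> \<Phi> ` zspan indicator ?X"
      then obtain \<phi> where \<phi>: "\<phi> \<in> zspan indicator ?X" "y = \<Phi> \<phi>" by blast
      from \<phi>(1) obtain S c where S: "finite S" "S \<subseteq> ?X" "\<phi> = (\<lambda>t. \<Sum>P\<in>S. c P * indicator P t)"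
        by (rule zspanE)
      show "y \<in> zspan (Fimg Q) ?X" unfolding \<phi>(2) S(3) val[OF S(1,2)] by (rule zspanI[OF S(1,2)])
    next
      fix y assume "y \<in> zspan (Fimg Q) ?X"
      then obtain S c where S: "finite S" "S \<subseteq> ?X" "y = (\<lambda>T. \<Sum>P\<in>S. c P * Fimg Q P T)" by (rule zspanE)
      then have "y = \<Phi> (\<lambda>t. \<Sum>P\<in>S. c P * indicator P t)" by (simp only: val)
      then show "y \<in> \<Phi> ` zspan indicator ?X" using zspanI[OF S(1,2)] by blast
    qed
    then show ?thesis using zspan_Fimg[OF assms] by simp
  qed
  ultimately have "bij_betw \<Phi> (zspan indicator ?X) (free_ab (tran Q))" by (simp add: bij_betw_def)
  then show "\<exists>\<Phi> :: ('a \<Rightarrow> int) \<Rightarrow> ('a set \<Rightarrow> int).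
          zlinear_fun_on (int_span ?X) \<Phi>
        \<and> (\<forall>P\<in>?X. \<Phi> (indicator P) = Fimg Q P)
        \<and> bij_betw \<Phi> (int_span ?X) (free_ab (tran Q))"
    unfolding span lin using \<Phi> by blast

  show "\<forall>\<Phi> \<Psi> :: ('a \<Rightarrow> int) \<Rightarrow> ('a set \<Rightarrow> int).
          zlinear_fun_on (int_span ?X) \<Phi> \<and> (\<forall>P\<in>?X. \<Phi> (indicator P) = Fimg Q P)
        \<and> zlinear_fun_on (int_span ?X) \<Psi> \<and> (\<forall>P\<in>?X. \<Psi> (indicator P) = Fimg Q P)
        \<longrightarrow> (\<forall>x\<in>int_span ?X. \<Phi> x = \<Psi> x)"
    unfolding span lin
  proof (intro allI impI ballI, elim conjE)
    fix \<Phi> \<Psi> :: "('a \<Rightarrow> int) \<Rightarrow> ('a set \<Rightarrow> int)" and x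
    assume lin: "zlinear_on (zspan indicator ?X) \<Phi>" "zlinear_on (zspan indicator ?X) \<Psi>"
      and "\<forall>P\<in>?X. \<Phi> (indicator P) = Fimg Q P" "\<forall>P\<in>?X. \<Psi> (indicator P) = Fimg Q P"
      and x: "x \<in> zspan indicator ?X"
    then have "\<Phi> (indicator P) = \<Psi> (indicator P)" if "P \<in> ?X" for P using that by simp
    from zlinear_on_zspan_unique[OF lin this x] show "\<Phi> x = \<Psi> x" .
  qed

  show "\<forall>f :: 'a set \<Rightarrow> 'b. valuative ?X f \<longrightarrow>
          (\<exists>g. zlinear_on (free_ab (tran Q)) g \<and> (\<forall>P\<in>?X. f P = g (Fimg Q P)))
        \<and> (\<forall>g1 g2. zlinear_on (free_ab (tran Q)) g1 \<and> (\<forall>P\<in>?X. f P = g1 (Fimg Q P))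
              \<and> zlinear_on (free_ab (tran Q)) g2 \<and> (\<forall>P\<in>?X. f P = g2 (Fimg Q P))
              \<longrightarrow> (\<forall>x\<in>free_ab (tran Q). g1 x = g2 x))"
    \<comment> \<open>The target is spanned by the \<open>Fimg Q P\<close>, so maps on it can be
      built and compared on these generators.\<close>
    unfolding zspan_Fimg[OF assms, symmetric]
  proof (intro allI impI conjI ballI)
    fix f :: "'a set \<Rightarrow> 'b" assume f: "valuative ?X f"
    have "\<exists>g. zlinear_on (zspan (Fimg Q) ?X) g \<and> (\<forall>P\<in>?X. g (Fimg Q P) = f P)"
    proof (rule zspan_factor)
      fix S c assume S: "finite S" "S \<subseteq> ?X" and z: "\<And>T. (\<Sum>P\<in>S. c P * Fimg Q P T) = 0"
      have "(\<lambda>x. \<Sum>P\<in>S. c P * (indicator P x :: int)) = (\<lambda>x. 0)" using rel[OF S, of c] z by blast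
      then show "(\<Sum>P\<in>S. zsmult (c P) (f P)) = 0" using f S unfolding valuative_def by blast
    qed
    then show "\<exists>g. zlinear_on (zspan (Fimg Q) ?X) g \<and> (\<forall>P\<in>?X. f P = g (Fimg Q P))" by metis
  next
    fix f :: "'a set \<Rightarrow> 'b" and g1 g2 x
    assume *: "zlinear_on (zspan (Fimg Q) ?X) g1 \<and> (\<forall>P\<in>?X. f P = g1 (Fimg Q P))
        \<and> zlinear_on (zspan (Fimg Q) ?X) g2 \<and> (\<forall>P\<in>?X. f P = g2 (Fimg Q P))"
      and x: "x \<in> zspan (Fimg Q) ?X"
    then have lin: "zlinear_on (zspan (Fimg Q) ?X) g1" "zlinear_on (zspan (Fimg Q) ?X) g2" by blast+
    have "g1 (Fimg Q P) = g2 (Fimg Q P)" if P: "P \<in> ?X" for P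
    proof -
      have "f P = g1 (Fimg Q P)" "f P = g2 (Fimg Q P)" using * P by blast+
      then show ?thesis by (rule trans[OF sym])
    qed
    from zlinear_on_zspan_unique[OF lin this x] show "g1 x = g2 x" .
  qed
qed

end
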